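(* Let $X,Y\colon\mathbb{R}\to\mathbf{Simp}$ be simplicial filtrations, let $P$ and $Q$ be the vertex sets of $\operatorname{colim}(X)$ and $\operatorname{colim}(Y)$ respectively, let $\delta\ge 0$, and let $C$ be a correspondence between $P$ and $Q$. If $C$ is $\delta$-simplicial, then for any stable and homotopy invariant distance $d$ on $\mathbb{R}$-spaces, $d(X,Y)\le\delta$.
   Context: $\mathbf{Top}$ is the category of compactly generated weakly Hausdorff (CGWH) spaces and continuous maps; all topological constructions are carried out in it. Regard $\mathbb{R}$ with its usual order as a category. An $\mathbb{R}$-space is a functor $X\colon\mathbb{R}\to\mathbf{Top}$; morphisms are natural transformations. $\mathbf{Simp}$ is the category of abstract simplicial complexes, regarded as a subcategory of $\mathbf{Top}$ via geometric realization. A simplicial filtration is a functor $X\colon\mathbb{R}\to\mathbf{Simp}$ whose internal maps $X_r\to X_s$ ($r\le s$) are inclusions of subcomplexes; it is regarded as an $\mathbb{R}$-space via geometric realization. A correspondence between sets $P$ and $Q$ is a subset $C\subset P\times Q$ whose coordinate projections $\mathrm{proj}_P\colon C\to P$ and $\mathrm{proj}_Q\colon C\to Q$ are surjective. A correspondence $C$ between $P$ and $Q$ is $\delta$-simplicial (with respect to $X$ and $Y$) if for every $r\in\mathbb{R}$: (1) for any simplex $\sigma\in X_r$, every finite nonempty subset of $\mathrm{proj}_Q(\mathrm{proj}_P^{-1}(\sigma))$ is a simplex in $Y_{r+\delta}$; and (2) for any simplex $\sigma\in Y_r$, every finite nonempty subset of $\mathrm{proj}_P(\mathrm{proj}_Q^{-1}(\sigma))$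 is a simplex in $X_{r+\delta}$. A distance on $\mathbb{R}$-spaces is an extended pseudometric on the class of $\mathbb{R}$-spaces, i.e. a symmetric function with values in $[0,\infty]$ satisfying the triangle inequality and $d(X,X)=0$. Sublevelset filtration: for $T\in\mathbf{Top}$ and a (not necessarily continuous) function $\gamma\colon T\to\mathbb{R}$, $\mathcal{S}(\gamma)_r=\gamma^{-1}(-\infty,r]$ with the subspace topology (in the CGWH sense, i.e. the k-ification of the usual subspace topology) and internal maps the inclusions; $d_\infty(\gamma,\kappa)=\sup_{x\in T}|\gamma(x)-\kappa(x)|$. A natural transformation $f\colon X\to Y$ of $\mathbb{R}$-spaces is an (objectwise) weak equivalence if each $f_r$ is a weak homotopy equivalence; $X\simeq Y$ means that $X$ and $Y$ are connected by a finite zigzag of objectwise weak equivalences. A distance $d$ is stable if $d(\mathcal{S}(\gamma),\mathcal{S}(\kappa))\le d_\infty(\gamma,\kappa)$ for every $T\in\mathbf{Top}$ and all functions $\gamma,\kappa\colon T\to\mathbb{R}$; it is homotopy invariant if $d(X,Y)=0$ whenever $X\simeq Y$. *)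

theory Defs
  imports "HOL-Analysis.Analysis"
begin

section \<open>Compactly generated weakly Hausdorff spaces\<close>

text \<open>
  The test spaces range over all compact Hausdorff spaces carried by a subset of \<^typ>\<open>'a set set\<close>,
  where \<^typ>\<open>'a\<close> carries the space under test.  Larger test spaces would not change the notions
  used here.  Given a map \<open>u\<close> from any compact Hausdorff space \<open>K\<close> to \<open>X\<close>, choose one
  preimage for each point of the image and let \<open>K'\<close> be the closure of the set of chosen points.
  Then \<open>K'\<close> has the same image as \<open>K\<close>, and its cardinality is at most that of
  \<^typ>\<open>'a set set\<close>.  So weak Hausdorffness is the usual one.  If \<open>X\<close> is weakly Hausdorff, then
  the image of \<open>K\<close> is a compact Hausdorff subspace of \<open>X\<close>, which is itself among the test spaces
  up to homeomorphism, so on weakly Hausdorff spaces k-ification and compact generation are the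
  usual ones as well.
\<close>

definition test_map :: "'a set set topology \<Rightarrow> 'a topology \<Rightarrow> ('a set set \<Rightarrow> 'a) \<Rightarrow> bool" where
  "test_map K X u \<longleftrightarrow> compact_space K \<and> Hausdorff_space K \<and> continuous_map K X u"

definition weakly_Hausdorff_space :: "'a topology \<Rightarrow> bool" where
  "weakly_Hausdorff_space X \<longleftrightarrow> (\<forall>K u. test_map K X u \<longrightarrow> closedin X (u ` topspace K))"

definition k_ification :: "'a topology \<Rightarrow> 'a topology" where
  "k_ification X = topology (\<lambda>U. U \<subseteq> topspace X \<and>
     (\<forall>K u. test_map K X u \<longrightarrow> openin K {z \<in> topspace K. u z \<in> U}))"

lemma openin_k_ification:
  "openin (k_ification X) U \<longleftrightarrow> U \<subseteq> topspace X \<and>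
     (\<forall>K u. test_map K X u \<longrightarrow> openin K {z \<in> topspace K. u z \<in> U})"
proof -
  have "istopology (\<lambda>U. U \<subseteq> topspace X \<and>
     (\<forall>K u. test_map K X u \<longrightarrow> openin K {z \<in> topspace K. u z \<in> U}))"
    unfolding istopology_def
  proof (intro conjI allI impI; (elim conjE)?)
    fix S T K and u :: "'a set set \<Rightarrow> 'a"
    assume "test_map K X u"
      and "\<forall>K u. test_map K X u \<longrightarrow> openin K {z \<in> topspace K. u z \<in> S}"
      and "\<forall>K u. test_map K X u \<longrightarrow> openin K {z \<in> topspace K. u z \<in> T}"
    then have "openin K ({z \<in> topspace K. u z \<in> S} \<inter> {z \<in> topspace K. u z \<in> T})"
      by blast
    then show "openin K {z \<in> topspace K. u z \<in> S \<inter> T}"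
      by (rule back_subst[where P = "openin K"]) auto
  next
    fix \<U> K and u :: "'a set set \<Rightarrow> 'a"
    assume "test_map K X u"
      and "\<forall>S\<in>\<U>. S \<subseteq> topspace X \<and>
        (\<forall>K u. test_map K X u \<longrightarrow> openin K {z \<in> topspace K. u z \<in> S})"
    then have "openin K (\<Union>S\<in>\<U>. {z \<in> topspace K. u z \<in> S})"
      by blast
    then show "openin K {z \<in> topspace K. u z \<in> \<Union>\<U>}"
      by (rule back_subst[where P = "openin K"]) auto
  qed auto
  then show ?thesis
    by (simp add: k_ification_def topology_inverse')
qed

definition compactly_generated_space :: "'a topology \<Rightarrow> bool" where
  "compactly_generated_space X \<longleftrightarrow> k_ification X = X"

definition CGWH_space :: "'a topology \<Rightarrow> bool" where
  "CGWH_space X \<longleftrightarrow> compactly_generated_space X \<and> weakly_Hausdorff_space X"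


section \<open>Weak homotopy equivalences\<close>

definition cube :: "nat \<Rightarrow> (nat \<Rightarrow> real) topology" where
  "cube n = product_topology (\<lambda>_. top_of_set {0..1}) {..<n}"

definition cube_boundary :: "nat \<Rightarrow> (nat \<Rightarrow> real) set" where
  "cube_boundary n = {t \<in> topspace (cube n). \<exists>i<n. t i = 0 \<or> t i = 1}"

definition spheroids :: "nat \<Rightarrow> 'a topology \<Rightarrow> 'a \<Rightarrow> ((nat \<Rightarrow> real) \<Rightarrow> 'a) set" where
  "spheroids n X x = {g. continuous_map (cube n) X g \<and> g ` cube_boundary n \<subseteq> {x}}"

definition spheroid_homotopic ::
  "nat \<Rightarrow> 'a topology \<Rightarrow> 'a \<Rightarrow> (((nat \<Rightarrow> real) \<Rightarrow> 'a) \<times> ((nat \<Rightarrow> real) \<Rightarrow> 'a)) set" where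
  "spheroid_homotopic n X x =
     {(g, h). homotopic_with (\<lambda>k. k ` cube_boundary n \<subseteq> {x}) (cube n) X g h}"

definition homotopy_classes :: "nat \<Rightarrow> 'a topology \<Rightarrow> 'a \<Rightarrow> ((nat \<Rightarrow> real) \<Rightarrow> 'a) set set" where
  "homotopy_classes n X x = spheroids n X x // spheroid_homotopic n X x"

definition induced_on_classes ::
  "nat \<Rightarrow> 'b topology \<Rightarrow> 'b \<Rightarrow> ('a \<Rightarrow> 'b) \<Rightarrow> ((nat \<Rightarrow> real) \<Rightarrow> 'a) set \<Rightarrow> ((nat \<Rightarrow> real) \<Rightarrow> 'b) set" where
  "induced_on_classes n Y y f c = spheroid_homotopic n Y y `` ((\<lambda>g. f \<circ> g) ` c)"

definition induced_on_path_components :: "'b topology \<Rightarrow> ('a \<Rightarrow> 'b) \<Rightarrow> 'a set \<Rightarrow> 'b set" where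
  "induced_on_path_components Y f A = {y. \<exists>x\<in>A. path_component_of Y (f x) y}"

text \<open>
  \<open>homotopy_classes n X x\<close> is the underlying set of the \<open>n\<close>-th homotopy group.  The induced maps
  are always group homomorphisms, so they are isomorphisms exactly when they are bijective.
\<close>

definition weak_homotopy_equivalence :: "'a topology \<Rightarrow> 'b topology \<Rightarrow> ('a \<Rightarrow> 'b) \<Rightarrow> bool" where
  "weak_homotopy_equivalence X Y f \<longleftrightarrow>
     continuous_map X Y f \<and>
     bij_betw (induced_on_path_components Y f) (path_components_of X) (path_components_of Y) \<and>
     (\<forall>x\<in>topspace X. \<forall>n\<ge>1.
        bij_betw (induced_on_classes n Y (f x) f)
          (homotopy_classes n X x) (homotopy_classes n Y (f x)))"


section \<open>\<open>\<real>\<close>-spaces\<close>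

record 'a rspace =
  space_at :: "real \<Rightarrow> 'a topology"
  internal_map :: "real \<Rightarrow> real \<Rightarrow> 'a \<Rightarrow> 'a"

definition is_rspace :: "'a rspace \<Rightarrow> bool" where
  "is_rspace X \<longleftrightarrow>
     (\<forall>r. CGWH_space (space_at X r)) \<and>
     (\<forall>r s. r \<le> s \<longrightarrow> continuous_map (space_at X r) (space_at X s) (internal_map X r s)) \<and>
     (\<forall>r. \<forall>x\<in>topspace (space_at X r). internal_map X r r x = x) \<and>
     (\<forall>r s t. r \<le> s \<longrightarrow> s \<le> t \<longrightarrow> (\<forall>x\<in>topspace (space_at X r).
        internal_map X s t (internal_map X r s x) = internal_map X r t x))"

definition natural_transformation :: "'a rspace \<Rightarrow> 'a rspace \<Rightarrow> (real \<Rightarrow> 'a \<Rightarrow> 'a) \<Rightarrow> bool" where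
  "natural_transformation X Y f \<longleftrightarrow>
     (\<forall>r. continuous_map (space_at X r) (space_at Y r) (f r)) \<and>
     (\<forall>r s. r \<le> s \<longrightarrow> (\<forall>x\<in>topspace (space_at X r).
        f s (internal_map X r s x) = internal_map Y r s (f r x)))"

definition objectwise_weak_equivalence :: "'a rspace \<Rightarrow> 'a rspace \<Rightarrow> (real \<Rightarrow> 'a \<Rightarrow> 'a) \<Rightarrow> bool" where
  "objectwise_weak_equivalence X Y f \<longleftrightarrow>
     natural_transformation X Y f \<and>
     (\<forall>r. weak_homotopy_equivalence (space_at X r) (space_at Y r) (f r))"

definition weakly_equivalent :: "'a rspace \<Rightarrow> 'a rspace \<Rightarrow> bool" where
  "weakly_equivalent =
     equivclp (\<lambda>X Y. is_rspace X \<and> is_rspace Y \<and> (\<exists>f. objectwise_weak_equivalence X Y f))"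


section \<open>Distances on \<open>\<real>\<close>-spaces\<close>

definition is_distance :: "('a rspace \<Rightarrow> 'a rspace \<Rightarrow> ennreal) \<Rightarrow> bool" where
  "is_distance d \<longleftrightarrow>
     (\<forall>X. is_rspace X \<longrightarrow> d X X = 0) \<and>
     (\<forall>X Y. is_rspace X \<longrightarrow> is_rspace Y \<longrightarrow> d X Y = d Y X) \<and>
     (\<forall>X Y Z. is_rspace X \<longrightarrow> is_rspace Y \<longrightarrow> is_rspace Z \<longrightarrow> d X Z \<le> d X Y + d Y Z)"

definition sublevel_filtration :: "'a topology \<Rightarrow> ('a \<Rightarrow> real) \<Rightarrow> 'a rspace" where
  "sublevel_filtration T \<gamma> =
     \<lparr>space_at = (\<lambda>r. k_ification (subtopology T {x \<in> topspace T. \<gamma> x \<le> r})),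
      internal_map = (\<lambda>r s x. x)\<rparr>"

definition sup_distance :: "'a topology \<Rightarrow> ('a \<Rightarrow> real) \<Rightarrow> ('a \<Rightarrow> real) \<Rightarrow> ennreal" where
  "sup_distance T \<gamma> \<kappa> = (SUP x\<in>topspace T. ennreal \<bar>\<gamma> x - \<kappa> x\<bar>)"

definition stable_distance :: "('a rspace \<Rightarrow> 'a rspace \<Rightarrow> ennreal) \<Rightarrow> bool" where
  "stable_distance d \<longleftrightarrow> (\<forall>T \<gamma> \<kappa>. CGWH_space T \<longrightarrow>
     d (sublevel_filtration T \<gamma>) (sublevel_filtration T \<kappa>) \<le> sup_distance T \<gamma> \<kappa>)"

definition homotopy_invariant :: "('a rspace \<Rightarrow> 'a rspace \<Rightarrow> ennreal) \<Rightarrow> bool" where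
  "homotopy_invariant d \<longleftrightarrow>
     (\<forall>X Y. is_rspace X \<longrightarrow> is_rspace Y \<longrightarrow> weakly_equivalent X Y \<longrightarrow> d X Y = 0)"


section \<open>Simplicial filtrations\<close>

definition simplicial_complex :: "'v set set \<Rightarrow> bool" where
  "simplicial_complex K \<longleftrightarrow>
     (\<forall>\<sigma>\<in>K. finite \<sigma> \<and> \<sigma> \<noteq> {}) \<and> (\<forall>\<sigma>\<in>K. \<forall>\<tau>. \<tau> \<subseteq> \<sigma> \<longrightarrow> \<tau> \<noteq> {} \<longrightarrow> \<tau> \<in> K)"

definition simplicial_filtration :: "(real \<Rightarrow> 'v set set) \<Rightarrow> bool" where
  "simplicial_filtration X \<longleftrightarrow>
     (\<forall>r. simplicial_complex (X r)) \<and> (\<forall>r s. r \<le> s \<longrightarrow> X r \<subseteq> X s)"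

text \<open>The internal maps are inclusions of subcomplexes, so the colimit is the union.\<close>

definition colim_complex :: "(real \<Rightarrow> 'v set set) \<Rightarrow> 'v set set" where
  "colim_complex X = (\<Union>r. X r)"

definition vertex_set :: "'v set set \<Rightarrow> 'v set" where
  "vertex_set K = {v. {v} \<in> K}"

definition correspondence :: "'p set \<Rightarrow> 'q set \<Rightarrow> ('p \<times> 'q) set \<Rightarrow> bool" where
  "correspondence P Q C \<longleftrightarrow> C \<subseteq> P \<times> Q \<and> fst ` C = P \<and> snd ` C = Q"

definition simplicial_correspondence ::
  "real \<Rightarrow> (real \<Rightarrow> 'p set set) \<Rightarrow> (real \<Rightarrow> 'q set set) \<Rightarrow> ('p \<times> 'q) set \<Rightarrow> bool" where
  "simplicial_correspondence \<delta> X Y C \<longleftrightarrow>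
     (\<forall>r. (\<forall>\<sigma>\<in>X r. \<forall>\<tau>. finite \<tau> \<longrightarrow> \<tau> \<noteq> {} \<longrightarrow> \<tau> \<subseteq> snd ` {c \<in> C. fst c \<in> \<sigma>} \<longrightarrow> \<tau> \<in> Y (r + \<delta>)) \<and>
          (\<forall>\<sigma>\<in>Y r. \<forall>\<tau>. finite \<tau> \<longrightarrow> \<tau> \<noteq> {} \<longrightarrow> \<tau> \<subseteq> fst ` {c \<in> C. snd c \<in> \<sigma>} \<longrightarrow> \<tau> \<in> X (r + \<delta>)))"

text \<open>
  Points of the geometric realization are given by barycentric coordinates.  Each closed simplex
  has its Euclidean topology, and the realization has the weak topology determined by the closed
  simplices.
\<close>

definition closed_simplex :: "'v set \<Rightarrow> ('v \<Rightarrow> real) set" where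
  "closed_simplex \<sigma> = {x. (\<forall>v. 0 \<le> x v) \<and> (\<forall>v. v \<notin> \<sigma> \<longrightarrow> x v = 0) \<and> (\<Sum>v\<in>\<sigma>. x v) = 1}"

definition geometric_realization :: "'v set set \<Rightarrow> ('v \<Rightarrow> real) topology" where
  "geometric_realization K = topology (\<lambda>U. U \<subseteq> (\<Union>\<sigma>\<in>K. closed_simplex \<sigma>) \<and>
     (\<forall>\<sigma>\<in>K. openin (subtopology (powertop_real UNIV) (closed_simplex \<sigma>)) (U \<inter> closed_simplex \<sigma>)))"

lemma openin_geometric_realization:
  "openin (geometric_realization K) U \<longleftrightarrow> U \<subseteq> (\<Union>\<sigma>\<in>K. closed_simplex \<sigma>) \<and>
     (\<forall>\<sigma>\<in>K. openin (subtopology (powertop_real UNIV) (closed_simplex \<sigma>)) (U \<inter> closed_simplex \<sigma>))"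
proof -
  have "istopology (\<lambda>U. U \<subseteq> (\<Union>\<sigma>\<in>K. closed_simplex \<sigma>) \<and>
     (\<forall>\<sigma>\<in>K. openin (subtopology (powertop_real UNIV) (closed_simplex \<sigma>)) (U \<inter> closed_simplex \<sigma>)))"
    unfolding istopology_def
  proof (intro conjI allI impI ballI; (elim conjE)?)
    fix S T \<sigma>
    assume "\<sigma> \<in> K"
      and "\<forall>\<sigma>\<in>K. openin (subtopology (powertop_real UNIV) (closed_simplex \<sigma>)) (S \<inter> closed_simplex \<sigma>)"
      and "\<forall>\<sigma>\<in>K. openin (subtopology (powertop_real UNIV) (closed_simplex \<sigma>)) (T \<inter> closed_simplex \<sigma>)"
    then have "openin (subtopology (powertop_real UNIV) (closed_simplex \<sigma>))
        ((S \<inter> closed_simplex \<sigma>) \<inter> (T \<inter> closed_simplex \<sigma>))"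
      by blast
    then show "openin (subtopology (powertop_real UNIV) (closed_simplex \<sigma>)) (S \<inter> T \<inter> closed_simplex \<sigma>)"
      by (rule back_subst[where P = "openin _"]) auto
  next
    fix \<U> \<sigma>
    assume "\<sigma> \<in> K"
      and "\<forall>S\<in>\<U>. S \<subseteq> (\<Union>\<sigma>\<in>K. closed_simplex \<sigma>) \<and>
        (\<forall>\<sigma>\<in>K. openin (subtopology (powertop_real UNIV) (closed_simplex \<sigma>)) (S \<inter> closed_simplex \<sigma>))"
    then have "openin (subtopology (powertop_real UNIV) (closed_simplex \<sigma>))
        (\<Union>S\<in>\<U>. S \<inter> closed_simplex \<sigma>)"
      by blast
    then show "openin (subtopology (powertop_real UNIV) (closed_simplex \<sigma>)) (\<Union>\<U> \<inter> closed_simplex \<sigma>)"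
      by (rule back_subst[where P = "openin _"]) auto
  qed auto
  then show ?thesis
    by (simp add: geometric_realization_def topology_inverse')
qed

text \<open>
  Distances are defined on the \<open>\<real>\<close>-spaces over one carrier type, so geometric realizations are
  transported to that type along an injection \<open>e\<close>.  The result is homeomorphic to the original
  space via \<open>e\<close>.
\<close>

definition transport_topology :: "('a \<Rightarrow> 'b) \<Rightarrow> 'a topology \<Rightarrow> 'b topology" where
  "transport_topology e X = pullback_topology (e ` topspace X) (inv e) X"

lemma homeomorphic_map_transport_topology:
  assumes "inj e"
  shows "homeomorphic_map X (transport_topology e X) e"
proof -
  have top: "topspace (transport_topology e X) = e ` topspace X"
    using assms by (auto simp: transport_topology_def topspace_pullback_topology)
  have "continuous_map X (transport_topology e X) e"
    unfolding transport_topology_def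
    by (rule continuous_map_pullback') (use assms in \<open>auto simp: o_def\<close>)
  moreover have "continuous_map (transport_topology e X) X (inv e)"
    unfolding transport_topology_def
    using continuous_map_pullback[OF continuous_map_id, of "e ` topspace X" "inv e" X]
    by (simp add: id_def o_def)
  ultimately have "homeomorphic_maps X (transport_topology e X) e (inv e)"
    using assms top by (auto simp: homeomorphic_maps_def)
  then show ?thesis
    using homeomorphic_maps_map by blast
qed

definition realization_rspace ::
  "(('v \<Rightarrow> real) \<Rightarrow> 'a) \<Rightarrow> (real \<Rightarrow> 'v set set) \<Rightarrow> 'a rspace" where
  "realization_rspace e X =
     \<lparr>space_at = (\<lambda>r. transport_topology e (geometric_realization (X r))),
      internal_map = (\<lambda>r s x. x)\<rparr>"

end

theory Submission
  imports Defs
begin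

text \<open>A correspondence gives no vertex map between \<open>P\<close> and \<open>Q\<close>. Over
  the common vertex set \<open>C\<close> its multivalued condition becomes a pair of inclusions, at
  the price of larger fibres. The parameters \<open>s\<close> and \<open>t\<close> are coordinates
  of \<open>T\<close> because entry times cannot replace them: the infimum of the times at which a
  point enters a filtration need not be finite or attained, so its sublevel sets may differ from the
  stages. Recording a time as a coordinate avoids any condition at the endpoint. Stability speaks
  about CGWH spaces only, so \<open>T\<close> is k-ified. Moreover, straight-line homotopies on an
  infinite complex need not be jointly continuous for the product topology; they are continuous
  along maps from compact spaces. The weak equivalences are therefore proved by lifting cubes.
  Because the deformation stays in the fibres, lifts with prescribed boundary values exist, and base
  points never have to be changed. Finally, \<open>d\<close> sees one carrier type only, known
  through the injections of the two realizations. Cardinal arithmetic places \<open>T\<close> on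
  that type.\<close>

text \<open>
  Pull both filtrations back to the vertex set \<open>C\<close>: let \<open>A\<^sub>r\<close> consist of the finite nonempty subsets
  of \<open>C\<close> whose projection to \<open>P\<close> is a simplex of \<open>X\<^sub>r\<close>, and \<open>B\<^sub>r\<close> likewise for \<open>Q\<close> and \<open>Y\<^sub>r\<close>.  That \<open>C\<close>
  is \<open>\<delta>\<close>-simplicial gives \<open>A\<^sub>r \<subseteq> B\<^bsub>r+\<delta>\<^esub>\<close> and \<open>B\<^sub>r \<subseteq> A\<^bsub>r+\<delta>\<^esub>\<close>.  On the space \<open>T\<close> of all triples \<open>(x, s, t)\<close> with
  \<open>x \<in> |A\<^sub>s| \<inter> |B\<^sub>t|\<close> and \<open>\<bar>s - t\<bar> \<le> \<delta>\<close>, the functions \<open>s\<close> and \<open>t\<close> differ by at most \<open>\<delta>\<close>, so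
  stability bounds the distance of their sublevel filtrations by \<open>\<delta>\<close>.  The projections of \<open>C\<close> induce
  maps from the two sublevel filtrations to \<open>X\<close> and \<open>Y\<close>.  Objectwise these maps have a section and
  deform onto it along their own fibres, hence they are weak equivalences.
\<close>

section \<open>k-ification\<close>

lemma topspace_k_ification [simp]: "topspace (k_ification X) = topspace X"
proof -
  have "openin (k_ification X) (topspace X)"
    unfolding openin_k_ification test_map_def
  proof (intro conjI allI impI subset_refl)
    fix K and u :: "'a set set \<Rightarrow> 'a"
    assume "compact_space K \<and> Hausdorff_space K \<and> continuous_map K X u"
    then have "{z \<in> topspace K. u z \<in> topspace X} = topspace K"
      by (auto simp: continuous_map_def)
    then show "openin K {z \<in> topspace K. u z \<in> topspace X}"
      by simp
  qed
  then show ?thesis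
    by (meson openin_k_ification openin_subset openin_topspace subset_antisym)
qed

lemma openin_k_ification_finer: "openin X U \<Longrightarrow> openin (k_ification X) U"
  by (auto simp: openin_k_ification test_map_def continuous_map_def dest: openin_subset)

lemma continuous_map_from_k_ification: "continuous_map X Y f \<Longrightarrow> continuous_map (k_ification X) Y f"
  by (auto simp: continuous_map_def openin_k_ification_finer)

lemma continuous_map_k_ification_id: "continuous_map (k_ification X) X (\<lambda>x. x)"
  using continuous_map_from_k_ification[OF continuous_map_id, of X] by (simp add: id_def)

lemma continuous_map_k_ification_full: "continuous_map W (k_ification X) f \<Longrightarrow> continuous_map W X f"
  using continuous_map_compose[OF _ continuous_map_k_ification_id] by (fastforce simp: o_def)

lemma continuous_map_into_k_ification_test:
  assumes "test_map K X u"
  shows "continuous_map K (k_ification X) u"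
  using assms by (auto simp: continuous_map_def openin_k_ification test_map_def)

lemma test_map_k_ification [simp]: "test_map K (k_ification X) u \<longleftrightarrow> test_map K X u"
  using continuous_map_into_k_ification_test continuous_map_k_ification_full
  by (metis test_map_def)

lemma k_ification_idem [simp]: "k_ification (k_ification X) = k_ification X"
  by (simp add: topology_eq openin_k_ification)

text \<open>Test maps into \<open>X\<close> are automatically continuous into
  \<open>k_ification X\<close>, so both subspaces have the same test maps. This later identifies the
  sublevel sets of a k-ified space.\<close>

lemma k_ification_subtopology_k_ification:
  "k_ification (subtopology (k_ification X) S) = k_ification (subtopology X S)"
proof -
  have "test_map K (subtopology (k_ification X) S) u \<longleftrightarrow> test_map K (subtopology X S) u" for K u
    using test_map_k_ification[of K X u]
    by (simp add: test_map_def continuous_map_in_subtopology) blast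
  then show ?thesis
    by (simp add: topology_eq openin_k_ification)
qed

text \<open>Composition with \<open>f\<close> turns test maps into \<open>X\<close> into test maps
  into \<open>Y\<close>. The common carrier type matters here, since it determines the type of the
  test spaces.\<close>

lemma continuous_map_k_ification:
  fixes X Y :: "'a topology"
  assumes "continuous_map X Y f"
  shows "continuous_map (k_ification X) (k_ification Y) f"
  unfolding continuous_map_def
proof (intro conjI allI impI)
  show "f \<in> topspace (k_ification X) \<rightarrow> topspace (k_ification Y)"
    using assms by (simp add: continuous_map_def)
  fix U assume U: "openin (k_ification Y) U"
  have "openin K {z \<in> topspace K. u z \<in> {x \<in> topspace X. f x \<in> U}}" if u: "test_map K X u" for K u
  proof -
    have "test_map K Y (f \<circ> u)"
      using u assms by (auto simp: test_map_def intro: continuous_map_compose)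
    then have "openin K {z \<in> topspace K. (f \<circ> u) z \<in> U}"
      using U unfolding openin_k_ification by blast
    moreover have "{z \<in> topspace K. (f \<circ> u) z \<in> U} = {z \<in> topspace K. u z \<in> {x \<in> topspace X. f x \<in> U}}"
      using u by (auto simp: test_map_def continuous_map_def)
    ultimately show ?thesis by simp
  qed
  then show "openin (k_ification X) {x \<in> topspace (k_ification X). f x \<in> U}"
    by (auto simp: openin_k_ification)
qed

lemma Hausdorff_imp_weakly_Hausdorff_space:
  assumes "Hausdorff_space X"
  shows "weakly_Hausdorff_space X"
  unfolding weakly_Hausdorff_space_def test_map_def
  using assms compactin_imp_closedin image_compactin compact_space_def by blast

lemma CGWH_space_k_ification:
  assumes "Hausdorff_space X"
  shows "CGWH_space (k_ification X)"
proof -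
  have "Hausdorff_space (k_ification X)"
    using Hausdorff_space_injective_preimage[OF assms continuous_map_k_ification_id] by simp
  then show ?thesis
    by (simp add: CGWH_space_def compactly_generated_space_def Hausdorff_imp_weakly_Hausdorff_space)
qed

section \<open>Transport along injections, and maps from compact spaces of another type\<close>

lemma topspace_transport_topology [simp]:
  assumes "inj e"
  shows "topspace (transport_topology e X) = e ` topspace X"
  using homeomorphic_map_transport_topology[OF assms] homeomorphic_imp_surjective_map by blast

lemma continuous_map_transport_topology:
  assumes "inj e"
  shows "continuous_map X (transport_topology e X) e"
    and "continuous_map (transport_topology e X) X (inv e)"
proof -
  show "continuous_map X (transport_topology e X) e"
    using homeomorphic_map_transport_topology[OF assms] homeomorphic_imp_continuous_map by blast
  show "continuous_map (transport_topology e X) X (inv e)"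
    unfolding transport_topology_def
    using continuous_map_pullback[OF continuous_map_id, of "e ` topspace X" "inv e" X]
    by (simp add: id_def o_def)
qed

lemma homeomorphic_space_transport_topology: "inj e \<Longrightarrow> X homeomorphic_space transport_topology e X"
  using homeomorphic_map_transport_topology homeomorphic_map_imp_homeomorphic_space by blast

text \<open>The injection \<open>j\<close> moves \<open>W\<close> onto the type of the test spaces,
  where it becomes a test space itself. It is used for simplices and for the compact spaces that
  parametrize homotopies.\<close>

lemma continuous_map_into_k_ification:
  fixes j :: "'w \<Rightarrow> 'a set set" and X :: "'a topology" and W :: "'w topology"
  assumes "inj j" "compact_space W" "Hausdorff_space W" "continuous_map W X f"
  shows "continuous_map W (k_ification X) f"
proof -
  let ?K = "transport_topology j W"
  have "test_map ?K X (f \<circ> inv j)"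
    unfolding test_map_def
    using assms homeomorphic_space_transport_topology[OF assms(1), of W]
      homeomorphic_compact_space homeomorphic_Hausdorff_space
      continuous_map_compose[OF continuous_map_transport_topology(2)[OF assms(1)] assms(4)]
    by blast
  then have "continuous_map W (k_ification X) ((f \<circ> inv j) \<circ> j)"
    by (rule continuous_map_compose[OF continuous_map_transport_topology(1)[OF assms(1)]
          continuous_map_into_k_ification_test])
  then show ?thesis
    using assms(1) by (simp add: o_def)
qed

section \<open>Geometric realizations\<close>

definition carrier :: "'v set set \<Rightarrow> ('v \<Rightarrow> real) set" where
  "carrier K = (\<Union>\<sigma>\<in>K. closed_simplex \<sigma>)"

lemma carrier_mono: "K \<subseteq> L \<Longrightarrow> carrier K \<subseteq> carrier L"
  by (auto simp: carrier_def)

abbreviation simplex_topology :: "'v set \<Rightarrow> ('v \<Rightarrow> real) topology" where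
  "simplex_topology \<sigma> \<equiv> subtopology (powertop_real UNIV) (closed_simplex \<sigma>)"

lemma closed_simplex_sum: "x \<in> closed_simplex \<sigma> \<Longrightarrow> sum x \<sigma> = 1"
  by (simp add: closed_simplex_def)

lemma closed_simplex_mono:
  assumes "\<sigma> \<subseteq> \<tau>" "finite \<tau>"
  shows "closed_simplex \<sigma> \<subseteq> closed_simplex \<tau>"
proof
  fix x assume x: "x \<in> closed_simplex \<sigma>"
  then have "sum x \<tau> = sum x \<sigma>"
    using assms by (intro sum.mono_neutral_right) (auto simp: closed_simplex_def)
  then show "x \<in> closed_simplex \<tau>"
    using x assms(1) by (auto simp: closed_simplex_def)
qed

lemma closed_simplex_convex:
  assumes "x \<in> closed_simplex \<sigma>" "y \<in> closed_simplex \<sigma>" "0 \<le> t" "t \<le> 1"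
  shows "(\<lambda>v. (1 - t) * x v + t * y v) \<in> closed_simplex \<sigma>"
  using assms by (auto simp: closed_simplex_def sum.distrib simp flip: sum_distrib_left)

lemma compactin_closed_simplex:
  assumes "finite \<sigma>"
  shows "compactin (powertop_real UNIV) (closed_simplex \<sigma>)"
proof -
  let ?B = "PiE UNIV (\<lambda>v. if v \<in> \<sigma> then {0..1::real} else {0})"
  have "compactin (powertop_real UNIV) ?B"
    by (auto simp: compactin_PiE)
  moreover have "closedin (powertop_real UNIV) {x \<in> topspace (powertop_real UNIV). sum x \<sigma> \<in> {1}}"
    by (rule closedin_continuous_map_preimage[where Y=euclideanreal])
       (use assms in \<open>auto intro!: continuous_map_sum continuous_map_product_projection\<close>)
  ultimately have "compactin (powertop_real UNIV)
      ({x \<in> topspace (powertop_real UNIV). sum x \<sigma> \<in> {1}} \<inter> ?B)"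
    by (rule closed_Int_compactin[rotated])
  also have "{x \<in> topspace (powertop_real UNIV). sum x \<sigma> \<in> {1}} \<inter> ?B = closed_simplex \<sigma>"
  proof (intro set_eqI iffI)
    fix x assume x: "x \<in> closed_simplex \<sigma>"
    have "x v \<le> 1" if "v \<in> \<sigma>" for v
      using member_le_sum[of v \<sigma> x] that x assms by (auto simp: closed_simplex_def)
    then show "x \<in> {x \<in> topspace (powertop_real UNIV). sum x \<sigma> \<in> {1}} \<inter> ?B"
      using x by (auto simp: closed_simplex_def PiE_iff)
  next
    fix x assume x: "x \<in> {x \<in> topspace (powertop_real UNIV). sum x \<sigma> \<in> {1}} \<inter> ?B"
    then have "x v \<in> (if v \<in> \<sigma> then {0..1} else {0})" for v
      by (auto simp: PiE_iff)
    then have "0 \<le> x v" "v \<notin> \<sigma> \<longrightarrow> x v = 0" for v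
      by (smt (verit) atLeastAtMost_iff singletonD)+
    then show "x \<in> closed_simplex \<sigma>"
      using x by (auto simp: closed_simplex_def)
  qed
  finally show ?thesis .
qed

lemma compact_space_simplex_topology: "finite \<sigma> \<Longrightarrow> compact_space (simplex_topology \<sigma>)"
  by (simp add: compact_space_subtopology compactin_closed_simplex)

lemma Hausdorff_space_powertop_real: "Hausdorff_space (powertop_real UNIV)"
  by (simp add: Hausdorff_space_product_topology)

lemma closedin_closed_simplex: "finite \<sigma> \<Longrightarrow> closedin (powertop_real UNIV) (closed_simplex \<sigma>)"
  by (simp add: compactin_imp_closedin Hausdorff_space_powertop_real compactin_closed_simplex)

lemma topspace_geometric_realization [simp]: "topspace (geometric_realization K) = carrier K"
proof -
  have "openin (simplex_topology \<sigma>) (carrier K \<inter> closed_simplex \<sigma>)" if "\<sigma> \<in> K" for \<sigma>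
  proof -
    have "carrier K \<inter> closed_simplex \<sigma> = topspace (simplex_topology \<sigma>)"
      using that by (auto simp: carrier_def)
    then show ?thesis by (metis openin_topspace)
  qed
  then have "openin (geometric_realization K) (carrier K)"
    by (auto simp: openin_geometric_realization carrier_def)
  then show ?thesis
    by (metis carrier_def openin_geometric_realization openin_subset openin_topspace subset_antisym)
qed

lemma closedin_geometric_realization:
  "closedin (geometric_realization K) V \<longleftrightarrow> V \<subseteq> carrier K \<and>
     (\<forall>\<sigma>\<in>K. closedin (simplex_topology \<sigma>) (V \<inter> closed_simplex \<sigma>))"
proof -
  have "openin (simplex_topology \<sigma>) ((carrier K - V) \<inter> closed_simplex \<sigma>) \<longleftrightarrow>
      closedin (simplex_topology \<sigma>) (V \<inter> closed_simplex \<sigma>)" if "\<sigma> \<in> K" for \<sigma>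
  proof -
    have "(carrier K - V) \<inter> closed_simplex \<sigma> = topspace (simplex_topology \<sigma>) - V \<inter> closed_simplex \<sigma>"
      using that by (auto simp: carrier_def)
    then show ?thesis
      unfolding closedin_def by simp
  qed
  then show ?thesis
    unfolding closedin_def[of "geometric_realization K"] openin_geometric_realization
    by (auto simp flip: carrier_def)
qed

lemma continuous_map_from_realization:
  assumes "\<And>\<sigma>. \<sigma> \<in> K \<Longrightarrow> continuous_map (simplex_topology \<sigma>) Y f"
  shows "continuous_map (geometric_realization K) Y f"
  unfolding continuous_map_def
proof (intro conjI allI impI)
  show "f \<in> topspace (geometric_realization K) \<rightarrow> topspace Y"
    using assms by (force simp: carrier_def continuous_map_def)
  fix U assume "openin Y U"
  then have "openin (simplex_topology \<sigma>) {x \<in> closed_simplex \<sigma>. f x \<in> U}" if "\<sigma> \<in> K" for \<sigma>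
    using openin_continuous_map_preimage[OF assms[OF that]] by simp
  moreover have "{x \<in> carrier K. f x \<in> U} \<inter> closed_simplex \<sigma> = {x \<in> closed_simplex \<sigma>. f x \<in> U}"
    if "\<sigma> \<in> K" for \<sigma>
    using that by (auto simp: carrier_def)
  ultimately show "openin (geometric_realization K) {x \<in> topspace (geometric_realization K). f x \<in> U}"
    by (auto simp: openin_geometric_realization simp flip: carrier_def)
qed

lemma continuous_map_realization_coordinates:
  "continuous_map (geometric_realization K) (powertop_real UNIV) (\<lambda>x. x)"
  by (rule continuous_map_from_realization) (simp add: continuous_map_from_subtopology flip: id_def)

lemma continuous_map_simplex_inclusion:
  assumes "\<sigma> \<in> K"
  shows "continuous_map (simplex_topology \<sigma>) (geometric_realization K) (\<lambda>x. x)"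
  unfolding continuous_map_def
proof (intro conjI allI impI)
  show "(\<lambda>x. x) \<in> topspace (simplex_topology \<sigma>) \<rightarrow> topspace (geometric_realization K)"
    using assms by (auto simp: carrier_def)
  fix U assume "openin (geometric_realization K) U"
  then have "openin (simplex_topology \<sigma>) (U \<inter> closed_simplex \<sigma>)"
    using assms by (simp add: openin_geometric_realization)
  then show "openin (simplex_topology \<sigma>) {x \<in> topspace (simplex_topology \<sigma>). x \<in> U}"
    by (simp add: Int_def conj_commute)
qed

lemma continuous_map_realization_inclusion:
  assumes "K \<subseteq> L"
  shows "continuous_map (geometric_realization K) (geometric_realization L) (\<lambda>x. x)"
  using assms by (intro continuous_map_from_realization continuous_map_simplex_inclusion) auto

lemma Hausdorff_space_geometric_realization: "Hausdorff_space (geometric_realization K)"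
  by (rule Hausdorff_space_injective_preimage[OF Hausdorff_space_powertop_real
        continuous_map_realization_coordinates]) simp

text \<open>Openness in a realization is decided on the closed simplices. These are compact
  Hausdorff, so every set that is open for the k-ification passes this test.\<close>

lemma CGWH_space_transport_realization:
  assumes "simplicial_complex K" "inj e"
  shows "CGWH_space (transport_topology e (geometric_realization K))"
proof -
  let ?T = "transport_topology e (geometric_realization K)"
  have "Hausdorff_space ?T"
    using homeomorphic_Hausdorff_space[OF homeomorphic_space_transport_topology[OF assms(2)]]
      Hausdorff_space_geometric_realization by blast
  moreover have "k_ification ?T = ?T"
  proof -
    have "openin ?T U" if U: "openin (k_ification ?T) U" for U
    proof -
      have "openin (simplex_topology \<sigma>) {x \<in> closed_simplex \<sigma>. e x \<in> U}" if s: "\<sigma> \<in> K" for \<sigma>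
      proof -
        have "continuous_map (simplex_topology \<sigma>) ?T (e \<circ> (\<lambda>x. x))"
          using continuous_map_compose[OF continuous_map_simplex_inclusion[OF s]]
            continuous_map_transport_topology(1)[OF assms(2)] by blast
        \<comment> \<open>Double singletons embed the coordinate functions into the type of the test
          spaces.\<close>
        moreover have "inj (\<lambda>x. {{e x}})"
          using assms(2) by (auto simp: inj_def)
        moreover have "finite \<sigma>"
          using assms(1) s by (auto simp: simplicial_complex_def)
        ultimately have "continuous_map (simplex_topology \<sigma>) (k_ification ?T) (e \<circ> (\<lambda>x. x))"
          by (intro continuous_map_into_k_ification compact_space_simplex_topology
              Hausdorff_space_subtopology[OF Hausdorff_space_powertop_real])
        from openin_continuous_map_preimage[OF this U] show ?thesis
          by simp
      qed
      moreover have "{x \<in> carrier K. e x \<in> U} \<inter> closed_simplex \<sigma> = {x \<in> closed_simplex \<sigma>. e x \<in> U}"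
        if "\<sigma> \<in> K" for \<sigma>
        using that by (auto simp: carrier_def)
      ultimately have "openin (geometric_realization K) {x \<in> carrier K. e x \<in> U}"
        by (auto simp: openin_geometric_realization simp flip: carrier_def)
      then have "openin ?T (e ` {x \<in> carrier K. e x \<in> U})"
        using homeomorphic_map_transport_topology[OF assms(2)] homeomorphic_imp_open_map
        unfolding open_map_def by blast
      moreover have "e ` {x \<in> carrier K. e x \<in> U} = U"
        using openin_subset[OF U] assms(2) by auto
      ultimately show ?thesis by simp
    qed
    then show ?thesis
      using openin_k_ification_finer by (metis topology_eq)
  qed
  ultimately show ?thesis
    by (simp add: CGWH_space_def compactly_generated_space_def Hausdorff_imp_weakly_Hausdorff_space)
qed

section \<open>Supports and finite subcomplexes\<close>

definition support :: "('v \<Rightarrow> real) \<Rightarrow> 'v set" where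
  "support x = {v. x v \<noteq> 0}"

lemma support_closed_simplex:
  assumes "x \<in> closed_simplex \<sigma>" "finite \<sigma>"
  shows "support x \<subseteq> \<sigma>" "support x \<noteq> {}" "x \<in> closed_simplex (support x)"
proof -
  show sub: "support x \<subseteq> \<sigma>"
    using assms by (auto simp: support_def closed_simplex_def)
  have eq: "sum x (support x) = 1"
    using assms sub closed_simplex_sum[OF assms(1)]
    by (subst sum.mono_neutral_left[of \<sigma>]) (auto simp: support_def)
  then show "support x \<noteq> {}"
    by auto
  show "x \<in> closed_simplex (support x)"
    using assms eq by (auto simp: closed_simplex_def support_def)
qed

lemma carrier_support:
  assumes "simplicial_complex K" "x \<in> carrier K"
  shows "support x \<in> K" "x \<in> closed_simplex (support x)"
proof -
  obtain \<sigma> where s: "\<sigma> \<in> K" "x \<in> closed_simplex \<sigma>"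
    using assms(2) by (auto simp: carrier_def)
  then have "finite \<sigma>"
    using assms(1) by (simp add: simplicial_complex_def)
  note * = support_closed_simplex[OF s(2) this]
  show "support x \<in> K"
    using assms(1) s(1) *(1,2) unfolding simplicial_complex_def by blast
  show "x \<in> closed_simplex (support x)"
    by (rule *(3))
qed

text \<open>Points of a compact set with pairwise distinct supports form a closed discrete subset,
  because a simplex has only finitely many faces.\<close>

lemma compactin_realization_finite:
  assumes K: "simplicial_complex K" and L: "compactin (geometric_realization K) L"
  obtains F where "finite F" "F \<subseteq> K" "L \<subseteq> carrier F"
proof -
  let ?G = "geometric_realization K"
  have sub: "L \<subseteq> carrier K"
    using compactin_subset_topspace[OF L] by simp
  have "finite (support ` L)"
  proof (rule ccontr)
    assume inf: "infinite (support ` L)"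
    define p where "p = inv_into L support"
    define D where "D = p ` support ` L"
    have supp_p: "support (p s) = s" "p s \<in> L" if "s \<in> support ` L" for s
      using that by (auto simp: p_def f_inv_into_f inv_into_into)
    have "infinite D"
      using inf unfolding D_def p_def by (simp add: finite_image_iff inj_on_inv_into)
    moreover have "D \<subseteq> L"
      using supp_p by (auto simp: D_def)
    ultimately obtain y where y: "y \<in> L" "y \<in> ?G derived_set_of D"
      using compactin_imp_Bolzano_Weierstrass[OF L] by blast
    \<comment> \<open>The limit point \<open>y\<close> may itself belong to \<open>D\<close>, so it
      is taken out: the complement of \<open>D - {y}\<close> is then a neighbourhood of
      \<open>y\<close> that meets \<open>D\<close> at most in \<open>y\<close>.\<close>
    have "closedin ?G (D - {y})"
      unfolding closedin_geometric_realization
    proof (intro conjI ballI)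
      show "D - {y} \<subseteq> carrier K"
        using \<open>D \<subseteq> L\<close> sub by blast
      fix \<sigma> assume "\<sigma> \<in> K"
      then have fin: "finite \<sigma>"
        using K by (auto simp: simplicial_complex_def)
      have "(D - {y}) \<inter> closed_simplex \<sigma> \<subseteq> p ` Pow \<sigma>"
      proof
        fix x assume x: "x \<in> (D - {y}) \<inter> closed_simplex \<sigma>"
        then obtain s where s: "s \<in> support ` L" "x = p s"
          by (auto simp: D_def)
        then have "s \<subseteq> \<sigma>"
          using support_closed_simplex(1)[of x \<sigma>] x fin supp_p by auto
        then show "x \<in> p ` Pow \<sigma>"
          using s by auto
      qed
      then have "finite ((D - {y}) \<inter> closed_simplex \<sigma>)"
        using fin by (meson finite_Pow_iff finite_imageI finite_subset)
      then show "closedin (simplex_topology \<sigma>) ((D - {y}) \<inter> closed_simplex \<sigma>)"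
        using Hausdorff_space_subtopology[OF Hausdorff_space_powertop_real, of "closed_simplex \<sigma>"]
        by (intro closedin_Hausdorff_finite) auto
    qed
    then have "openin ?G (topspace ?G - (D - {y}))"
      by blast
    moreover have "y \<in> topspace ?G - (D - {y})"
      using y(1) compactin_subset_topspace[OF L] by auto
    ultimately obtain z where "z \<noteq> y" "z \<in> D" "z \<in> topspace ?G - (D - {y})"
      using y(2) unfolding in_derived_set_of by metis
    then show False
      by blast
  qed
  moreover have "support ` L \<subseteq> K"
    using carrier_support(1)[OF K] sub by blast
  moreover have "L \<subseteq> carrier (support ` L)"
  proof
    fix x assume x: "x \<in> L"
    then have "x \<in> closed_simplex (support x)"
      using carrier_support(2)[OF K] sub by auto
    then show "x \<in> carrier (support ` L)"
      using x by (auto simp: carrier_def)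
  qed
  ultimately show thesis
    using that by blast
qed

text \<open>On a finite subcomplex the weak topology is the coordinate topology: the trace of a
  closed set is a finite union of pieces, each closed in the product of lines. Continuity can thus
  be checked coordinatewise.\<close>

lemma continuous_map_into_realization:
  assumes "simplicial_complex K" "finite F" "F \<subseteq> K"
    and f: "continuous_map W (powertop_real UNIV) f" "f ` topspace W \<subseteq> carrier F"
  shows "continuous_map W (geometric_realization K) f"
  unfolding continuous_map_closedin
proof (intro conjI allI impI)
  show "f \<in> topspace W \<rightarrow> topspace (geometric_realization K)"
    using f(2) carrier_mono[OF assms(3)] by auto
  fix V assume V: "closedin (geometric_realization K) V"
  have "closedin W {z \<in> topspace W. f z \<in> V \<inter> closed_simplex \<sigma>}" if "\<sigma> \<in> F" for \<sigma>
  proof -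
    have "\<sigma> \<in> K" "finite \<sigma>"
      using that assms by (auto simp: simplicial_complex_def)
    then have "closedin (powertop_real UNIV) (V \<inter> closed_simplex \<sigma>)"
      using V closedin_closed_simplex closedin_trans_full closedin_geometric_realization by metis
    then show ?thesis
      by (rule closedin_continuous_map_preimage[OF f(1)])
  qed
  then have "closedin W (\<Union>\<sigma>\<in>F. {z \<in> topspace W. f z \<in> V \<inter> closed_simplex \<sigma>})"
    using \<open>finite F\<close> by (intro closedin_Union) auto
  moreover have "(\<Union>\<sigma>\<in>F. {z \<in> topspace W. f z \<in> V \<inter> closed_simplex \<sigma>}) = {z \<in> topspace W. f z \<in> V}"
    using f(2) by (auto simp: carrier_def)
  ultimately show "closedin W {z \<in> topspace W. f z \<in> V}"
    by simp
qed

lemma continuous_map_realization_coordinate: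
  assumes "continuous_map W (geometric_realization K) f"
  shows "continuous_map W euclideanreal (\<lambda>z. f z v)"
  using continuous_map_compose[OF assms continuous_map_realization_coordinates]
  by (simp add: continuous_map_componentwise_UNIV o_def)

text \<open>Compactness of \<open>W\<close> confines both endpoint maps to finite subcomplexes.
  Closure of \<open>K\<close> under unions then gives one finite subcomplex that contains all the
  segments, where coordinatewise continuity suffices.\<close>

lemma continuous_map_realization_linear:
  assumes K: "simplicial_complex K" "\<And>\<sigma> \<tau>. \<sigma> \<in> K \<Longrightarrow> \<tau> \<in> K \<Longrightarrow> \<sigma> \<union> \<tau> \<in> K"
    and W: "compact_space W"
    and x: "continuous_map W (geometric_realization K) x"
    and y: "continuous_map W (geometric_realization K) y"
    and t: "continuous_map W euclideanreal t" "t ` topspace W \<subseteq> {0..1}"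
  shows "continuous_map W (geometric_realization K) (\<lambda>z v. (1 - t z) * x z v + t z * y z v)"
proof -
  obtain F where F: "finite F" "F \<subseteq> K" "x ` topspace W \<subseteq> carrier F"
    using compactin_realization_finite[OF K(1) image_compactin[OF _ x]] W
    unfolding compact_space_def by metis
  obtain G where G: "finite G" "G \<subseteq> K" "y ` topspace W \<subseteq> carrier G"
    using compactin_realization_finite[OF K(1) image_compactin[OF _ y]] W
    unfolding compact_space_def by metis
  let ?F = "(\<lambda>(\<sigma>, \<tau>). \<sigma> \<union> \<tau>) ` (F \<times> G)"
  show ?thesis
  proof (rule continuous_map_into_realization[OF K(1), of ?F])
    show "finite ?F"
      using F G by blast
    show "?F \<subseteq> K"
      using F(2) G(2) K(2) by (auto simp: subset_iff)
    show "continuous_map W (powertop_real UNIV) (\<lambda>z v. (1 - t z) * x z v + t z * y z v)"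
      unfolding continuous_map_componentwise_UNIV
      by (intro allI continuous_intros t continuous_map_realization_coordinate[OF x]
          continuous_map_realization_coordinate[OF y])
    show "(\<lambda>z v. (1 - t z) * x z v + t z * y z v) ` topspace W \<subseteq> carrier ?F"
    proof (clarify)
      fix z assume z: "z \<in> topspace W"
      obtain \<sigma> \<tau> where st: "\<sigma> \<in> F" "x z \<in> closed_simplex \<sigma>" "\<tau> \<in> G" "y z \<in> closed_simplex \<tau>"
        using subsetD[OF F(3) imageI[OF z]] subsetD[OF G(3) imageI[OF z]]
        unfolding carrier_def by blast
      then have "finite (\<sigma> \<union> \<tau>)"
        using K(1) F(2) G(2) by (auto simp: simplicial_complex_def)
      then have "x z \<in> closed_simplex (\<sigma> \<union> \<tau>)" "y z \<in> closed_simplex (\<sigma> \<union> \<tau>)"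
        using st closed_simplex_mono[of \<sigma> "\<sigma> \<union> \<tau>"] closed_simplex_mono[of \<tau> "\<sigma> \<union> \<tau>"] by auto
      then have "(\<lambda>v. (1 - t z) * x z v + t z * y z v) \<in> closed_simplex (\<sigma> \<union> \<tau>)"
        using t(2) z by (intro closed_simplex_convex) auto
      then show "(\<lambda>v. (1 - t z) * x z v + t z * y z v) \<in> carrier ?F"
        using st by (auto simp: carrier_def)
    qed
  qed
qed

section \<open>Simplicial maps\<close>

text \<open>The realization of the vertex map \<open>\<phi>\<close>: the pushforward of
  \<open>x\<close> as a measure on vertices. Restricting the sum to the support keeps it finite on a
  realization even when \<open>\<phi>\<close> has infinite fibres.\<close>

definition push :: "('v \<Rightarrow> 'w) \<Rightarrow> ('v \<Rightarrow> real) \<Rightarrow> 'w \<Rightarrow> real" where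
  "push \<phi> x w = (\<Sum>v | x v \<noteq> 0 \<and> \<phi> v = w. x v)"

text \<open>A fixed finite index set replaces the support, which varies with \<open>x\<close>; in
  this form linearity and continuity in \<open>x\<close> are visible.\<close>

lemma push_eq_sum:
  assumes "finite \<sigma>" "\<And>v. v \<notin> \<sigma> \<Longrightarrow> x v = 0"
  shows "push \<phi> x w = (\<Sum>v\<in>\<sigma>. if \<phi> v = w then x v else 0)"
proof -
  have "push \<phi> x w = (\<Sum>v | x v \<noteq> 0 \<and> \<phi> v = w. if \<phi> v = w then x v else 0)"
    by (simp add: push_def)
  also have "\<dots> = (\<Sum>v\<in>\<sigma>. if \<phi> v = w then x v else 0)"
    using assms by (intro sum.mono_neutral_left) auto
  finally show ?thesis .
qed

lemma push_closed_simplex: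
  assumes "finite \<sigma>" "x \<in> closed_simplex \<sigma>"
  shows "push \<phi> x \<in> closed_simplex (\<phi> ` \<sigma>)"
proof -
  have eq: "push \<phi> x w = (\<Sum>v\<in>\<sigma>. if \<phi> v = w then x v else 0)" for w
    using assms by (intro push_eq_sum) (auto simp: closed_simplex_def)
  have "(\<Sum>w\<in>\<phi> ` \<sigma>. push \<phi> x w) = (\<Sum>v\<in>\<sigma>. \<Sum>w\<in>\<phi> ` \<sigma>. if \<phi> v = w then x v else 0)"
    unfolding eq by (rule sum.swap)
  also have "\<dots> = 1"
    using assms by (simp add: closed_simplex_def)
  finally show ?thesis
    using assms by (auto simp: closed_simplex_def eq intro!: sum_nonneg sum.neutral)
qed

lemma push_push:
  assumes "finite \<sigma>" "x \<in> closed_simplex \<sigma>"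
  shows "push \<psi> (push \<phi> x) = push (\<psi> \<circ> \<phi>) x"
proof
  fix u
  have x: "x v = 0" if "v \<notin> \<sigma>" for v
    using that assms by (auto simp: closed_simplex_def)
  have "push \<psi> (push \<phi> x) u = (\<Sum>w\<in>\<phi> ` \<sigma>. if \<psi> w = u then push \<phi> x w else 0)"
    using assms push_closed_simplex[OF assms, of \<phi>]
    by (intro push_eq_sum) (auto simp: closed_simplex_def)
  also have "\<dots> = (\<Sum>w\<in>\<phi> ` \<sigma>. \<Sum>v\<in>\<sigma>. if \<phi> v = w then (if \<psi> w = u then x v else 0) else 0)"
    by (intro sum.cong refl) (auto simp: push_eq_sum[OF assms(1) x] intro!: sum.cong sum.neutral)
  also have "\<dots> = (\<Sum>v\<in>\<sigma>. \<Sum>w\<in>\<phi> ` \<sigma>. if \<phi> v = w then (if \<psi> w = u then x v else 0) else 0)"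
    by (rule sum.swap)
  also have "\<dots> = push (\<psi> \<circ> \<phi>) x u"
    using assms(1) by (simp add: push_eq_sum[OF assms(1) x])
  finally show "push \<psi> (push \<phi> x) u = push (\<psi> \<circ> \<phi>) x u" .
qed

lemma push_ident:
  assumes "finite \<sigma>" "x \<in> closed_simplex \<sigma>" "\<And>v. v \<in> \<sigma> \<Longrightarrow> \<phi> v = v"
  shows "push \<phi> x = x"
proof
  fix w
  have "push \<phi> x w = (\<Sum>v\<in>\<sigma>. if v = w then x v else 0)"
    using assms by (subst push_eq_sum[of \<sigma>]) (auto simp: closed_simplex_def intro!: sum.cong)
  then show "push \<phi> x w = x w"
    using assms by (auto simp: closed_simplex_def)
qed

lemma push_linear:
  assumes "finite \<sigma>" "x \<in> closed_simplex \<sigma>" "y \<in> closed_simplex \<sigma>"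
  shows "push \<phi> (\<lambda>v. a * x v + b * y v) = (\<lambda>w. a * push \<phi> x w + b * push \<phi> y w)"
proof
  fix w
  have out: "x v = 0" "y v = 0" if "v \<notin> \<sigma>" for v
    using that assms by (auto simp: closed_simplex_def)
  have "push \<phi> (\<lambda>v. a * x v + b * y v) w
      = (\<Sum>v\<in>\<sigma>. if \<phi> v = w then a * x v + b * y v else 0)"
    using out by (intro push_eq_sum[OF assms(1)]) auto
  also have "\<dots> = (\<Sum>v\<in>\<sigma>. a * (if \<phi> v = w then x v else 0) + b * (if \<phi> v = w then y v else 0))"
    by (intro sum.cong) auto
  also have "\<dots> = a * push \<phi> x w + b * push \<phi> y w"
    using out by (simp add: push_eq_sum[OF assms(1)] sum.distrib sum_distrib_left)
  finally show "push \<phi> (\<lambda>v. a * x v + b * y v) w = a * push \<phi> x w + b * push \<phi> y w" .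
qed

lemma continuous_map_push:
  assumes K: "simplicial_complex K" and L: "simplicial_complex L"
    and \<phi>: "\<And>\<sigma>. \<sigma> \<in> K \<Longrightarrow> \<phi> ` \<sigma> \<in> L"
  shows "continuous_map (geometric_realization K) (geometric_realization L) (push \<phi>)"
proof (rule continuous_map_from_realization)
  fix \<sigma> assume s: "\<sigma> \<in> K"
  then have fin: "finite \<sigma>"
    using K by (auto simp: simplicial_complex_def)
  have eq: "push \<phi> x w = (\<Sum>v\<in>\<sigma>. if \<phi> v = w then x v else 0)" if "x \<in> closed_simplex \<sigma>" for x w
    using that by (intro push_eq_sum[OF fin]) (auto simp: closed_simplex_def)
  show "continuous_map (simplex_topology \<sigma>) (geometric_realization L) (push \<phi>)"
  proof (rule continuous_map_into_realization[OF L, of "{\<phi> ` \<sigma>}"])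
    have "continuous_map (simplex_topology \<sigma>) euclideanreal (\<lambda>x. push \<phi> x w)" for w
    proof (rule continuous_map_eq)
      show "continuous_map (simplex_topology \<sigma>) euclideanreal
          (\<lambda>x. \<Sum>v\<in>\<sigma>. if \<phi> v = w then x v else 0)"
      proof (intro continuous_map_sum fin)
        fix v
        have "continuous_map (simplex_topology \<sigma>) euclideanreal (\<lambda>x. x v)"
          by (intro continuous_map_from_subtopology continuous_map_product_projection) simp
        then show "continuous_map (simplex_topology \<sigma>) euclideanreal (\<lambda>x. if \<phi> v = w then x v else 0)"
          by (cases "\<phi> v = w") auto
      qed
    qed (simp add: eq)
    then show "continuous_map (simplex_topology \<sigma>) (powertop_real UNIV) (push \<phi>)"
      by (simp add: continuous_map_componentwise_UNIV)
  qed (use s \<phi> push_closed_simplex[OF fin] in \<open>auto simp: carrier_def\<close>)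
qed

section \<open>Shrinkable maps are weak homotopy equivalences\<close>

abbreviation interval :: "real topology" where
  "interval \<equiv> top_of_set {0..1}"

lemma topspace_cube: "topspace (cube n) = PiE {..<n} (\<lambda>_. {0..1})"
  by (simp add: cube_def)

lemma continuous_map_into_cube:
  assumes "\<And>i. i < n \<Longrightarrow> continuous_map W euclideanreal (\<lambda>z. F z i)"
    and "\<And>z i. z \<in> topspace W \<Longrightarrow> i < n \<Longrightarrow> 0 \<le> F z i \<and> F z i \<le> 1"
  shows "continuous_map W (cube n) (\<lambda>z. \<lambda>i\<in>{..<n}. F z i)"
  unfolding cube_def continuous_map_componentwise
  using assms by (auto simp: continuous_map_in_subtopology image_subset_iff)

lemma continuous_map_cube_coordinate:
  assumes "i < n"
  shows "continuous_map (cube n) euclideanreal (\<lambda>z. z i)"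
proof -
  have "continuous_map (cube n) interval (\<lambda>z. z i)"
    unfolding cube_def using assms by (intro continuous_map_product_projection) auto
  then show ?thesis
    using continuous_map_into_fulltopology by blast
qed

lemma compact_space_cube: "compact_space (cube n)"
  by (simp add: cube_def compact_space_product_topology compact_space_subtopology)

lemma Hausdorff_space_cube: "Hausdorff_space (cube n)"
  by (simp add: cube_def Hausdorff_space_product_topology Hausdorff_space_subtopology)

abbreviation cylinder :: "nat \<Rightarrow> (real \<times> (nat \<Rightarrow> real)) topology" where
  "cylinder n \<equiv> prod_topology interval (cube n)"

lemma compact_space_cylinder: "compact_space (cylinder n)"
  by (simp add: compact_space_prod_topology compact_space_cube compact_space_subtopology)

lemma Hausdorff_space_cylinder: "Hausdorff_space (cylinder n)"
  by (simp add: Hausdorff_space_prod_topology Hausdorff_space_cube Hausdorff_space_subtopology)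

lemma continuous_map_cylinder_height: "continuous_map (cylinder n) euclideanreal fst"
  using continuous_map_fst[of interval "cube n"] continuous_map_into_fulltopology by blast

lemma continuous_map_cylinder_coordinate:
  "i < n \<Longrightarrow> continuous_map (cylinder n) euclideanreal (\<lambda>z. snd z i)"
  using continuous_map_compose[OF continuous_map_snd continuous_map_cube_coordinate]
  by (auto simp: o_def)

text \<open>Twice the maximum-norm distance from the centre, so that the boundary has radius 1. The
  recursion gives continuity by induction, and the value 0 in dimension 0 agrees with the empty
  boundary there.\<close>

primrec cube_radius :: "nat \<Rightarrow> (nat \<Rightarrow> real) \<Rightarrow> real" where
  "cube_radius 0 z = 0"
| "cube_radius (Suc n) z = max (cube_radius n z) \<bar>2 * z n - 1\<bar>"

lemma cube_radius_ge: "i < n \<Longrightarrow> \<bar>2 * z i - 1\<bar> \<le> cube_radius n z"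
  by (induction n) (auto simp: less_Suc_eq)

lemma cube_radius_attained: "cube_radius n z = 0 \<or> (\<exists>i<n. cube_radius n z = \<bar>2 * z i - 1\<bar>)"
  by (induction n) (auto simp: max_def less_Suc_eq)

lemma cube_radius_le_1: "z \<in> topspace (cube n) \<Longrightarrow> cube_radius n z \<le> 1"
  using cube_radius_attained[of n z] by (force simp: topspace_cube PiE_iff)

lemma cube_radius_eq_1:
  assumes "z \<in> topspace (cube n)"
  shows "cube_radius n z = 1 \<longleftrightarrow> z \<in> cube_boundary n"
proof
  assume "cube_radius n z = 1"
  then obtain i where "i < n" "\<bar>2 * z i - 1\<bar> = 1"
    using cube_radius_attained[of n z] by auto
  then have "z i = 0 \<or> z i = 1"
    by linarith
  then show "z \<in> cube_boundary n"
    using assms \<open>i < n\<close> by (auto simp: cube_boundary_def)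
next
  assume "z \<in> cube_boundary n"
  then obtain i where "i < n" "z i = 0 \<or> z i = 1"
    by (auto simp: cube_boundary_def)
  then have "1 \<le> cube_radius n z"
    using cube_radius_ge[of i n z] by auto
  then show "cube_radius n z = 1"
    using cube_radius_le_1[OF assms] by simp
qed

lemma continuous_map_cube_radius:
  "(\<And>i. i < n \<Longrightarrow> continuous_map W euclideanreal (\<lambda>z. F z i)) \<Longrightarrow>
    continuous_map W euclideanreal (\<lambda>z. cube_radius n (F z))"
  by (induction n) (auto intro!: continuous_intros)

text \<open>Dilation by the factor \<open>1 / a\<close> about the centre. The restriction is there
  because points of the cube are extensional functions.\<close>

definition scale :: "nat \<Rightarrow> real \<Rightarrow> (nat \<Rightarrow> real) \<Rightarrow> nat \<Rightarrow> real" where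
  "scale n a z = (\<lambda>i\<in>{..<n}. 1/2 + (z i - 1/2) / a)"

lemma cube_radius_scale:
  assumes "0 < a"
  shows "cube_radius n (scale n a z) = cube_radius n z / a"
proof -
  have "cube_radius m (scale n a z) = cube_radius m z / a" if "m \<le> n" for m
    using that
  proof (induction m)
    case (Suc m)
    have "2 * scale n a z m - 1 = (2 * z m - 1) / a"
      using Suc.prems assms by (simp add: scale_def field_simps)
    then have "\<bar>2 * scale n a z m - 1\<bar> = \<bar>2 * z m - 1\<bar> / a"
      using assms by simp
    then show ?case
      using Suc assms by (simp add: max_divide_distrib_right)
  qed simp
  then show ?thesis by simp
qed

lemma scale_1: "z \<in> topspace (cube n) \<Longrightarrow> scale n 1 z = z"
  by (auto simp: scale_def topspace_cube PiE_iff extensional_def fun_eq_iff)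

lemma continuous_map_scale:
  assumes "continuous_map W euclideanreal a" "continuous_map W (cube n) F"
    and a: "\<And>z. z \<in> topspace W \<Longrightarrow> 0 < a z \<and> cube_radius n (F z) \<le> a z"
  shows "continuous_map W (cube n) (\<lambda>z. scale n (a z) (F z))"
  unfolding scale_def
proof (rule continuous_map_into_cube)
  fix i assume i: "i < n"
  have "continuous_map W euclideanreal (\<lambda>z. F z i)"
    using continuous_map_compose[OF assms(2) continuous_map_cube_coordinate[OF i]] by (simp add: o_def)
  then show "continuous_map W euclideanreal (\<lambda>z. 1/2 + (F z i - 1/2) / a z)"
    using a assms(1) by (intro continuous_intros) force+
  fix z assume z: "z \<in> topspace W"
  have "\<bar>2 * F z i - 1\<bar> \<le> a z" "0 < a z"
    using a[OF z] cube_radius_ge[OF i, of "F z"] by auto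
  then have "- (a z / 2) \<le> F z i - 1/2" "F z i - 1/2 \<le> a z / 2"
    by (auto simp: abs_le_iff)
  then have "- (1/2) \<le> (F z i - 1/2) / a z" "(F z i - 1/2) / a z \<le> 1/2"
    using \<open>0 < a z\<close> by (auto simp: field_simps)
  then show "0 \<le> 1/2 + (F z i - 1/2) / a z \<and> 1/2 + (F z i - 1/2) / a z \<le> 1"
    by linarith
qed

text \<open>A collar of the set \<open>\<rho> = 1\<close>: the map \<open>c\<close> stretches the region \<open>\<rho> \<le> 1/2\<close> over the whole
  space and retracts the region \<open>\<rho> \<ge> 1/2\<close> onto the set \<open>\<rho> = 1\<close>.\<close>

definition collar :: "'w topology \<Rightarrow> ('w \<Rightarrow> real) \<Rightarrow> ('w \<Rightarrow> 'w) \<Rightarrow> bool" where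
  "collar W \<rho> c \<longleftrightarrow> continuous_map W euclideanreal \<rho> \<and> continuous_map W W c \<and>
     (\<forall>z\<in>topspace W. \<rho> z \<le> 1 \<and> (1/2 \<le> \<rho> z \<longrightarrow> \<rho> (c z) = 1) \<and> (\<rho> z = 1 \<longrightarrow> c z = z))"

text \<open>Dividing by \<open>max (1/2) \<rho>\<close> doubles the part
  \<open>\<rho> \<le> 1/2\<close> and normalizes the rest to radius 1. Only the cube coordinates
  count here, so data are prescribed on the side of the cylinder and the two ends stay free; this
  serves to lift spheroids.\<close>

lemma collar_cube_in_cylinder:
  "collar (cylinder n) (\<lambda>z. cube_radius n (snd z))
     (\<lambda>z. (fst z, scale n (max (1/2) (cube_radius n (snd z))) (snd z)))"
proof -
  have rad: "continuous_map (cylinder n) euclideanreal (\<lambda>z. cube_radius n (snd z))"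
    by (intro continuous_map_cube_radius continuous_map_cylinder_coordinate)
  show ?thesis
    unfolding collar_def
  proof (intro conjI ballI impI rad)
    show "continuous_map (cylinder n) (cylinder n)
        (\<lambda>z. (fst z, scale n (max (1/2) (cube_radius n (snd z))) (snd z)))"
      by (intro continuous_map_pairedI continuous_map_scale continuous_intros rad
          continuous_map_fst continuous_map_snd) auto
  qed (auto simp: cube_radius_le_1 cube_radius_scale scale_1)
qed

definition cylinder_radius :: "nat \<Rightarrow> real \<times> (nat \<Rightarrow> real) \<Rightarrow> real" where
  "cylinder_radius n z = max \<bar>2 * fst z - 1\<bar> (cube_radius n (snd z))"

lemma cylinder_radius_eq_1:
  assumes "z \<in> topspace (cylinder n)"
  shows "cylinder_radius n z = 1 \<longleftrightarrow> fst z = 0 \<or> fst z = 1 \<or> snd z \<in> cube_boundary n"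
proof -
  have "snd z \<in> topspace (cube n)" "0 \<le> fst z" "fst z \<le> 1"
    using assms by auto
  then show ?thesis
    using cube_radius_eq_1[of "snd z" n] cube_radius_le_1[of "snd z" n]
    unfolding cylinder_radius_def by linarith
qed

text \<open>The same rescaling with the height included in the radius, so data are prescribed on the
  side and on both ends; this serves to lift homotopies.\<close>

lemma collar_cylinder:
  "collar (cylinder n) (cylinder_radius n)
     (\<lambda>z. (1/2 + (fst z - 1/2) / max (1/2) (cylinder_radius n z),
           scale n (max (1/2) (cylinder_radius n z)) (snd z)))"
proof -
  have rad: "continuous_map (cylinder n) euclideanreal (cylinder_radius n)"
    unfolding cylinder_radius_def
    by (intro continuous_intros continuous_map_cube_radius continuous_map_cylinder_coordinate
        continuous_map_cylinder_height)
  have le: "\<bar>2 * fst z - 1\<bar> \<le> cylinder_radius n z" "cube_radius n (snd z) \<le> cylinder_radius n z" for z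
    by (auto simp: cylinder_radius_def)
  show ?thesis
    unfolding collar_def
  proof (intro conjI ballI impI rad)
    show "continuous_map (cylinder n) (cylinder n)
        (\<lambda>z. (1/2 + (fst z - 1/2) / max (1/2) (cylinder_radius n z),
           scale n (max (1/2) (cylinder_radius n z)) (snd z)))"
    proof (intro continuous_map_pairedI continuous_map_scale continuous_intros rad continuous_map_snd)
      show "continuous_map (cylinder n) interval (\<lambda>z. 1/2 + (fst z - 1/2) / max (1/2) (cylinder_radius n z))"
      proof (rule continuous_map_into_subtopology)
        show "continuous_map (cylinder n) euclidean
            (\<lambda>z. 1/2 + (fst z - 1/2) / max (1/2) (cylinder_radius n z))"
          by (intro continuous_intros rad continuous_map_cylinder_height) auto
        show "(\<lambda>z. 1/2 + (fst z - 1/2) / max (1/2) (cylinder_radius n z)) \<in> topspace (cylinder n) \<rightarrow> {0..1}"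
        proof
          fix z :: "real \<times> (nat \<Rightarrow> real)"
          define a where "a = max (1/2) (cylinder_radius n z)"
          have "0 < a" "\<bar>2 * fst z - 1\<bar> \<le> a"
            using le(1)[of z] by (auto simp: a_def)
          then have "- (a / 2) \<le> fst z - 1/2" "fst z - 1/2 \<le> a / 2"
            by (auto simp: abs_le_iff)
          then have "- (1/2) \<le> (fst z - 1/2) / a" "(fst z - 1/2) / a \<le> 1/2"
            using \<open>0 < a\<close> by (auto simp: field_simps)
          then have "0 \<le> 1/2 + (fst z - 1/2) / a" "1/2 + (fst z - 1/2) / a \<le> 1"
            by linarith+
          then show "1/2 + (fst z - 1/2) / max (1/2) (cylinder_radius n z) \<in> {0..1}"
            unfolding a_def atLeastAtMost_iff by blast
        qed
      qed
    qed (use le in \<open>auto simp: le_max_iff_disj\<close>)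
  next
    fix z assume z: "z \<in> topspace (cylinder n)"
    show "cylinder_radius n z \<le> 1"
      using z cube_radius_le_1[of "snd z" n] by (auto simp: cylinder_radius_def)
    show "cylinder_radius n (1/2 + (fst z - 1/2) / max (1/2) (cylinder_radius n z),
           scale n (max (1/2) (cylinder_radius n z)) (snd z)) = 1" if "1/2 \<le> cylinder_radius n z"
    proof -
      define a where "a = cylinder_radius n z"
      have a: "0 < a" "max (1/2) (cylinder_radius n z) = a"
        using that by (auto simp: a_def)
      have "2 * (1/2 + (fst z - 1/2) / a) - 1 = (2 * fst z - 1) / a"
        using a(1) by (simp add: field_simps)
      then have "\<bar>2 * (1/2 + (fst z - 1/2) / a) - 1\<bar> = \<bar>2 * fst z - 1\<bar> / a"
        using a(1) by simp
      then have "cylinder_radius n (1/2 + (fst z - 1/2) / a, scale n a (snd z))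
          = max \<bar>2 * fst z - 1\<bar> (cube_radius n (snd z)) / a"
        using a(1) by (simp add: cylinder_radius_def cube_radius_scale max_divide_distrib_right)
      also have "\<dots> = 1"
        using a(1) by (simp add: a_def cylinder_radius_def)
      finally show ?thesis
        by (simp only: a(2))
    qed
    show "(1/2 + (fst z - 1/2) / max (1/2) (cylinder_radius n z),
           scale n (max (1/2) (cylinder_radius n z)) (snd z)) = z" if "cylinder_radius n z = 1"
      using that z by (auto simp: scale_1)
  qed
qed

text \<open>The homotopy \<open>H\<close> need not be jointly continuous on \<open>S\<close>; for homotopy groups it is enough that
  it is continuous along maps from compact Hausdorff spaces.\<close>

locale shrinkable =
  fixes S :: "'a topology" and A :: "'b topology" and f :: "'a \<Rightarrow> 'b" and g :: "'b \<Rightarrow> 'a"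
    and H :: "real \<Rightarrow> 'a \<Rightarrow> 'a"
  assumes cont_f: "continuous_map S A f"
    and cont_g: "continuous_map A S g"
    and f_g: "\<And>y. y \<in> topspace A \<Longrightarrow> f (g y) = y"
    and H_0: "\<And>x. x \<in> topspace S \<Longrightarrow> H 0 x = x"
    and H_1: "\<And>x. x \<in> topspace S \<Longrightarrow> H 1 x = g (f x)"
    and f_H: "\<And>t x. x \<in> topspace S \<Longrightarrow> 0 \<le> t \<Longrightarrow> t \<le> 1 \<Longrightarrow> f (H t x) = f x"
    and cont_H: "\<And>(W :: (real \<times> (nat \<Rightarrow> real)) topology) w t.
       compact_space W \<Longrightarrow> Hausdorff_space W \<Longrightarrow> continuous_map W S w \<Longrightarrow>
       continuous_map W euclideanreal t \<Longrightarrow> t ` topspace W \<subseteq> {0..1} \<Longrightarrow>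
       continuous_map W S (\<lambda>z. H (t z) (w z))"
begin

text \<open>The inner region carries the lift \<open>g \<circ> J \<circ> c\<close>. Across the
  collar, \<open>H\<close> joins it to the prescribed \<open>\<phi>\<close> inside the fibres of
  \<open>f\<close>, so the projection is still \<open>J \<circ> c\<close>. The result lifts
  \<open>J\<close> up to this reparametrization, which is all that is used.\<close>

lemma lift_rel_collar:
  fixes W :: "(real \<times> (nat \<Rightarrow> real)) topology"
  assumes W: "compact_space W" "Hausdorff_space W" and col: "collar W \<rho> c"
    and J: "continuous_map W A J"
    and \<phi>: "continuous_map (subtopology W {z \<in> topspace W. \<rho> z = 1}) S \<phi>"
    and comp: "\<And>z. z \<in> topspace W \<Longrightarrow> \<rho> z = 1 \<Longrightarrow> f (\<phi> z) = J z"
  obtains N where "continuous_map W S N"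
    "\<And>z. z \<in> topspace W \<Longrightarrow> \<rho> z = 1 \<Longrightarrow> N z = \<phi> z"
    "\<And>z. z \<in> topspace W \<Longrightarrow> f (N z) = J (c z)"
proof
  \<comment> \<open>The time \<open>2 - 2 * \<rho> z\<close> is 1 at \<open>\<rho> z = 1/2\<close>,
    where \<open>H\<close> yields \<open>g (f (\<phi> (c z)))\<close> and the two cases agree, and 0
    at \<open>\<rho> z = 1\<close>, where \<open>\<phi>\<close> is recovered.\<close>
  define N where "N z = (if \<rho> z \<le> 1/2 then g (J (c z)) else H (2 - 2 * \<rho> z) (\<phi> (c z)))" for z
  have \<rho>: "continuous_map W euclideanreal \<rho>" and c: "continuous_map W W c"
    using col by (auto simp: collar_def)
  have cz: "c z \<in> topspace W" if "z \<in> topspace W" for z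
    using c that by (auto simp: continuous_map_def)
  have bd: "\<phi> z \<in> topspace S" if "z \<in> topspace W" "\<rho> z = 1" for z
    using \<phi> that by (auto simp: continuous_map_def)
  let ?V = "subtopology W {z \<in> topspace W. 1/2 \<le> \<rho> z}"
  \<comment> \<open>The homotopy \<open>H\<close> is continuous only along compact Hausdorff spaces,
    so the outer region has to be compact.\<close>
  have "closedin W {z \<in> topspace W. \<rho> z \<in> {1/2..}}"
    by (rule closedin_continuous_map_preimage[OF \<rho>]) simp
  then have "compact_space ?V"
    using W(1) by (simp add: closedin_compact_space compact_space_subtopology)
  moreover have "Hausdorff_space ?V"
    by (simp add: W(2) Hausdorff_space_subtopology)
  moreover have "continuous_map ?V S (\<phi> \<circ> c)"
  proof (rule continuous_map_compose[OF _ \<phi>])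
    show "continuous_map ?V (subtopology W {z \<in> topspace W. \<rho> z = 1}) c"
      using col by (intro continuous_map_into_subtopology continuous_map_from_subtopology c)
        (auto simp: collar_def cz)
  qed
  moreover have "continuous_map ?V euclideanreal (\<lambda>z. 2 - 2 * \<rho> z)"
    by (intro continuous_intros continuous_map_from_subtopology \<rho>)
  ultimately have outer: "continuous_map ?V S (\<lambda>z. H (2 - 2 * \<rho> z) ((\<phi> \<circ> c) z))"
    using col by (intro cont_H[where w = "\<phi> \<circ> c"]) (auto simp: collar_def)
  show "continuous_map W S N"
    unfolding N_def
  proof (rule continuous_map_cases_le[OF \<rho>])
    show "continuous_map (subtopology W {z \<in> topspace W. \<rho> z \<le> 1/2}) S (\<lambda>z. g (J (c z)))"
      using continuous_map_compose[OF continuous_map_compose[OF c J] cont_g]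
      by (intro continuous_map_from_subtopology) (simp add: o_def)
    show "continuous_map ?V S (\<lambda>z. H (2 - 2 * \<rho> z) (\<phi> (c z)))"
      using outer by simp
    show "g (J (c z)) = H (2 - 2 * \<rho> z) (\<phi> (c z))" if "z \<in> topspace W" "\<rho> z = 1/2" for z
    proof -
      have "\<rho> (c z) = 1" "2 - 2 * \<rho> z = 1"
        using col that by (auto simp: collar_def)
      then show ?thesis
        using that(1) cz bd comp H_1 by simp
    qed
  qed simp
  show "N z = \<phi> z" if "z \<in> topspace W" "\<rho> z = 1" for z
    using that col H_0 bd by (auto simp: N_def collar_def)
  show "f (N z) = J (c z)" if z: "z \<in> topspace W" for z
  proof (cases "\<rho> z \<le> 1/2")
    case True
    have "J (c z) \<in> topspace A"
      using J cz[OF z] by (auto simp: continuous_map_def)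
    with True show ?thesis
      by (simp add: N_def f_g)
  next
    case False
    then have "\<rho> (c z) = 1" "\<rho> z \<le> 1"
      using col z by (auto simp: collar_def)
    then show ?thesis
      using False cz[OF z] bd comp f_H by (simp add: N_def)
  qed
qed

text \<open>Every required value of \<open>N\<close> lies on the boundary of the cylinder, so a lift
  relative to \<open>collar_cylinder\<close> suffices. How \<open>N\<close> projects in the interior
  is irrelevant to the conclusion.\<close>

lemma lift_homotopy:
  assumes k: "continuous_map (cube n) S k\<^sub>0" "continuous_map (cube n) S k\<^sub>1"
    and eq: "\<And>z. z \<in> cube_boundary n \<Longrightarrow> k\<^sub>0 z = k\<^sub>1 z"
    and J: "continuous_map (cylinder n) A J"
    and J01: "\<And>z. z \<in> topspace (cube n) \<Longrightarrow> J (0, z) = f (k\<^sub>0 z)"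
      "\<And>z. z \<in> topspace (cube n) \<Longrightarrow> J (1, z) = f (k\<^sub>1 z)"
    and Jbd: "\<And>t z. 0 \<le> t \<Longrightarrow> t \<le> 1 \<Longrightarrow> z \<in> cube_boundary n \<Longrightarrow> J (t, z) = f (k\<^sub>0 z)"
  obtains N where "continuous_map (cylinder n) S N"
    "\<And>z. z \<in> topspace (cube n) \<Longrightarrow> N (0, z) = k\<^sub>0 z"
    "\<And>z. z \<in> topspace (cube n) \<Longrightarrow> N (1, z) = k\<^sub>1 z"
    "\<And>t z. 0 \<le> t \<Longrightarrow> t \<le> 1 \<Longrightarrow> z \<in> cube_boundary n \<Longrightarrow> N (t, z) = k\<^sub>0 z"
proof -
  \<comment> \<open>On the boundary, the level 1/2 meets only the side, where
    \<open>k\<^sub>0\<close> and \<open>k\<^sub>1\<close> agree; hence this case split is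
    continuous.\<close>
  let ?\<phi> = "\<lambda>z. if fst z \<le> 1/2 then k\<^sub>0 (snd z) else k\<^sub>1 (snd z)"
  let ?B = "subtopology (cylinder n) {z \<in> topspace (cylinder n). cylinder_radius n z = 1}"
  have bd: "z \<in> topspace (cube n)" if "z \<in> cube_boundary n" for z
    using that by (simp add: cube_boundary_def)
  have \<phi>: "continuous_map ?B S ?\<phi>"
  proof (rule continuous_map_cases_le)
    show "continuous_map ?B euclideanreal fst"
      by (intro continuous_map_from_subtopology continuous_map_cylinder_height)
    show "continuous_map (subtopology ?B {z \<in> topspace ?B. fst z \<le> 1/2}) S (\<lambda>z. k\<^sub>0 (snd z))"
      "continuous_map (subtopology ?B {z \<in> topspace ?B. 1/2 \<le> fst z}) S (\<lambda>z. k\<^sub>1 (snd z))"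
      using continuous_map_compose[OF continuous_map_snd k(1)] continuous_map_compose[OF continuous_map_snd k(2)]
      by (auto intro!: continuous_map_from_subtopology simp: o_def)
    show "k\<^sub>0 (snd z) = k\<^sub>1 (snd z)" if "z \<in> topspace ?B" "fst z = 1/2" for z
      using that eq cylinder_radius_eq_1[of z n] by auto
  qed simp
  have comp: "f (?\<phi> z) = J z" if "z \<in> topspace (cylinder n)" "cylinder_radius n z = 1" for z
    using that(1) iffD1[OF cylinder_radius_eq_1[OF that(1)] that(2)] J01 Jbd eq
    by (cases z) auto
  obtain N where N: "continuous_map (cylinder n) S N"
    "\<And>z. z \<in> topspace (cylinder n) \<Longrightarrow> cylinder_radius n z = 1 \<Longrightarrow> N z = ?\<phi> z"
  proof (rule lift_rel_collar[OF compact_space_cylinder Hausdorff_space_cylinder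
          collar_cylinder[of n] J \<phi>])
    show "f (?\<phi> z) = J z" if "z \<in> topspace (cylinder n)" "cylinder_radius n z = 1" for z
      by (rule comp[OF that])
  qed (rule that)
  have N': "N (t, z) = ?\<phi> (t, z)"
    if "0 \<le> t" "t \<le> 1" "z \<in> topspace (cube n)" "t = 0 \<or> t = 1 \<or> z \<in> cube_boundary n" for t z
    using that cylinder_radius_eq_1[of "(t, z)" n] by (intro N(2)) auto
  show thesis
  proof
    show "N (t, z) = k\<^sub>0 z" if "0 \<le> t" "t \<le> 1" "z \<in> cube_boundary n" for t z
      using that N'[of t z] bd eq by auto
  qed (use N(1) N' in auto)
qed

section \<open>Path components and homotopy groups of a shrinkable map\<close>

lemma path_component_reflect:
  assumes "x \<in> topspace S" "y \<in> topspace S" "path_component_of A (f x) (f y)"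
  shows "path_component_of S x y"
proof -
  obtain q where q: "pathin A q" "q 0 = f x" "q 1 = f y"
    using assms(3) by (auto simp: path_component_of_def)
  \<comment> \<open>A path is a homotopy over the one-point cube of dimension 0. Its empty boundary
    makes the side conditions of \<open>lift_homotopy\<close> void.\<close>
  have bd: "cube_boundary 0 = {}"
    by (simp add: cube_boundary_def)
  obtain N where N: "continuous_map (cylinder 0) S N"
    "\<And>z. z \<in> topspace (cube 0) \<Longrightarrow> N (0, z) = x" "\<And>z. z \<in> topspace (cube 0) \<Longrightarrow> N (1, z) = y"
  proof (rule lift_homotopy[of 0 "\<lambda>_. x" "\<lambda>_. y" "q \<circ> fst"])
    show "continuous_map (cylinder 0) A (q \<circ> fst)"
      using q(1) by (intro continuous_map_compose[OF continuous_map_fst]) (simp add: pathin_def)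
  qed (use assms q bd in auto)
  have pt: "(\<lambda>_. undefined) \<in> topspace (cube 0)"
    by (simp add: topspace_cube)
  have "pathin S (N \<circ> (\<lambda>t. (t, \<lambda>_. undefined)))"
    unfolding pathin_def using pt
    by (intro continuous_map_compose[OF _ N(1)] continuous_map_pairedI) (auto simp flip: id_def)
  then show ?thesis
    unfolding path_component_of_def using N(2,3)[OF pt] by force
qed

lemma bij_path_components:
  "bij_betw (induced_on_path_components A f) (path_components_of S) (path_components_of A)"
proof -
  let ?F = "induced_on_path_components A f"
  have path_f: "path_component_of A (f x) (f y)" if xy: "path_component_of S x y" for x y
  proof -
    obtain q where "pathin S q" "q 0 = x" "q 1 = y"
      using xy by (auto simp: path_component_of_def)
    then have "pathin A (f \<circ> q)" "(f \<circ> q) 0 = f x" "(f \<circ> q) 1 = f y"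
      using continuous_map_compose[OF _ cont_f] by (auto simp: pathin_def)
    then show ?thesis
      unfolding path_component_of_def by blast
  qed
  have F: "?F (path_component_of_set S x) = path_component_of_set A (f x)" if "x \<in> topspace S" for x
    unfolding induced_on_path_components_def
    using that path_f path_component_of_refl path_component_of_trans by fastforce
  show ?thesis
    unfolding bij_betw_def
  proof
    show "inj_on ?F (path_components_of S)"
    proof (rule inj_onI)
      fix U V assume "U \<in> path_components_of S" "V \<in> path_components_of S" and eq: "?F U = ?F V"
      then obtain x y where xy: "x \<in> topspace S" "y \<in> topspace S"
        "U = path_component_of_set S x" "V = path_component_of_set S y"
        by (auto simp: path_components_of_def)
      have "f y \<in> topspace A"
        using xy cont_f by (auto simp: continuous_map_def)
      then have "path_component_of A (f x) (f y)"
        using eq F xy path_component_of_refl by (metis mem_Collect_eq)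
      then show "U = V"
        using path_component_reflect[of x y] xy
        by (metis path_component_of_equiv)
    qed
    show "?F ` path_components_of S = path_components_of A"
    proof -
      have "f ` topspace S = topspace A"
        using cont_f cont_g f_g by (force simp: continuous_map_def image_iff Pi_iff)
      then have "path_components_of A = (\<lambda>x. path_component_of_set A (f x)) ` topspace S"
        by (metis path_components_of_def image_image)
      then show ?thesis
        using F by (simp add: path_components_of_def image_image)
    qed
  qed
qed

text \<open>The obvious candidate \<open>g \<circ> h\<close> is based at \<open>g (f x)\<close>
  rather than at \<open>x\<close>. The collar joins the two points inside the fibre over
  \<open>f x\<close>; the lift then projects to a rescaled \<open>h\<close>, which is homotopic to
  \<open>h\<close> relative to the boundary.\<close>

lemma lift_spheroid:
  assumes x: "x \<in> topspace S" and h: "h \<in> spheroids n A (f x)"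
  obtains k where "k \<in> spheroids n S x"
    "homotopic_with (\<lambda>k. k ` cube_boundary n \<subseteq> {f x}) (cube n) A (f \<circ> k) h"
proof -
  let ?r = "\<lambda>z. max (1/2) (cube_radius n z)"
  have hc: "continuous_map (cube n) A h" and hb: "\<And>z. z \<in> cube_boundary n \<Longrightarrow> h z = f x"
    using h by (auto simp: spheroids_def)
  obtain N where N: "continuous_map (cylinder n) S N"
    "\<And>z. z \<in> topspace (cylinder n) \<Longrightarrow> cube_radius n (snd z) = 1 \<Longrightarrow> N z = x"
    "\<And>z. z \<in> topspace (cylinder n) \<Longrightarrow> f (N z) = (h \<circ> snd) (fst z, scale n (?r (snd z)) (snd z))"
  proof (rule lift_rel_collar[OF compact_space_cylinder Hausdorff_space_cylinder
        collar_cube_in_cylinder[of n], of "h \<circ> snd" "\<lambda>_. x"])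
    show "continuous_map (cylinder n) A (h \<circ> snd)"
      by (intro continuous_map_compose[OF continuous_map_snd hc])
    show "f x = (h \<circ> snd) z" if "z \<in> topspace (cylinder n)" "cube_radius n (snd z) = 1" for z
      using that cube_radius_eq_1[of "snd z" n] hb by auto
  qed (use x in auto)
  \<comment> \<open>The cylinder enters only because \<open>lift_rel_collar\<close> works on its
    type. Neither the data nor the collar on the cube depends on the height, so the slice at 0 will
    do.\<close>
  define k where "k = N \<circ> Pair 0"
  have k: "continuous_map (cube n) S k"
    unfolding k_def by (intro continuous_map_o_Pair[OF N(1)]) simp
  have "k z = x" if "z \<in> cube_boundary n" for z
    using that N(2)[of "(0, z)"] cube_radius_eq_1[of z n] by (auto simp: k_def cube_boundary_def)
  then have "k \<in> spheroids n S x"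
    using k by (auto simp: spheroids_def)
  moreover have "homotopic_with (\<lambda>k. k ` cube_boundary n \<subseteq> {f x}) (cube n) A (f \<circ> k) h"
  proof (subst homotopic_with)
    show "(p ` cube_boundary n \<subseteq> {f x}) = (q ` cube_boundary n \<subseteq> {f x})"
      if "\<And>z. z \<in> topspace (cube n) \<Longrightarrow> p z = q z" for p q
      using that by (auto simp: cube_boundary_def)
    \<comment> \<open>The straight-line homotopy in the cube from the rescaling to the identity. It
      fixes boundary points, where the rescaling is already the identity.\<close>
    define L where "L = (\<lambda>(t, z). \<lambda>i\<in>{..<n}. (1 - t) * scale n (?r z) z i + t * z i)"
    have rad: "continuous_map (cylinder n) euclideanreal (\<lambda>z. ?r (snd z))"
      by (intro continuous_intros continuous_map_cube_radius continuous_map_cylinder_coordinate)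
    have sc: "continuous_map (cylinder n) (cube n) (\<lambda>z. scale n (?r (snd z)) (snd z))"
      by (intro continuous_map_scale rad continuous_map_snd) auto
    have L: "continuous_map (cylinder n) (cube n) L"
      unfolding L_def case_prod_beta
    proof (rule continuous_map_into_cube)
      fix i assume i: "i < n"
      have "continuous_map (cylinder n) euclideanreal (\<lambda>z. scale n (?r (snd z)) (snd z) i)"
        using continuous_map_compose[OF sc continuous_map_cube_coordinate[OF i]] by (simp add: o_def)
      then show "continuous_map (cylinder n) euclideanreal
          (\<lambda>z. (1 - fst z) * scale n (?r (snd z)) (snd z) i + fst z * snd z i)"
        by (intro continuous_intros continuous_map_cylinder_height
            continuous_map_cylinder_coordinate i)
      fix z assume z: "z \<in> topspace (cylinder n)"
      then have "scale n (?r (snd z)) (snd z) \<in> topspace (cube n)"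
        using sc unfolding continuous_map_def by blast
      then show "0 \<le> (1 - fst z) * scale n (?r (snd z)) (snd z) i + fst z * snd z i \<and>
          (1 - fst z) * scale n (?r (snd z)) (snd z) i + fst z * snd z i \<le> 1"
        using z i convex_bound_le[of "scale n (?r (snd z)) (snd z) i" 1 "snd z i" "1 - fst z" "fst z"]
        by (auto simp: topspace_cube PiE_iff)
    qed
    have ext: "(\<lambda>i\<in>{..<n}. z i) = z" if "z \<in> topspace (cube n)" for z
      using that unfolding topspace_cube by (intro PiE_restrict) auto
    show "\<exists>M. continuous_map (cylinder n) A M \<and> (\<forall>z\<in>topspace (cube n). M (0, z) = (f \<circ> k) z) \<and>
        (\<forall>z\<in>topspace (cube n). M (1, z) = h z) \<and>
        (\<forall>t\<in>{0..1}. (\<lambda>z. M (t, z)) ` cube_boundary n \<subseteq> {f x})"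
    proof (intro exI[of _ "h \<circ> L"] conjI ballI)
      show "continuous_map (cylinder n) A (h \<circ> L)"
        by (rule continuous_map_compose[OF L hc])
      show "(h \<circ> L) (0, z) = (f \<circ> k) z" if "z \<in> topspace (cube n)" for z
      proof -
        have "L (0, z) = scale n (?r z) z"
          by (simp add: L_def scale_def fun_eq_iff)
        then show ?thesis
          using that N(3)[of "(0, z)"] by (simp add: k_def)
      qed
      show "(h \<circ> L) (1, z) = h z" if "z \<in> topspace (cube n)" for z
        using ext[OF that] by (simp add: L_def)
      show "(\<lambda>z. (h \<circ> L) (t, z)) ` cube_boundary n \<subseteq> {f x}" for t
      proof clarify
        fix z assume z: "z \<in> cube_boundary n"
        then have top: "z \<in> topspace (cube n)"
          by (simp add: cube_boundary_def)
        then have "scale n (?r z) z = z"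
          using z cube_radius_eq_1[OF top] scale_1[OF top] by simp
        then have "L (t, z) = z"
          using ext[OF top] by (simp add: L_def algebra_simps)
        then show "(h \<circ> L) (t, z) = f x"
          using hb[OF z] by simp
      qed
    qed
  qed
  ultimately show thesis
    using that by blast
qed

text \<open>Surjectivity comes from \<open>lift_spheroid\<close>. For injectivity,
  \<open>lift_homotopy\<close> turns a based homotopy between projections into one between the
  spheroids themselves.\<close>

lemma bij_homotopy_classes:
  assumes x: "x \<in> topspace S"
  shows "bij_betw (induced_on_classes n A (f x) f) (homotopy_classes n S x) (homotopy_classes n A (f x))"
proof -
  let ?RS = "spheroid_homotopic n S x" and ?RA = "spheroid_homotopic n A (f x)"
  let ?F = "induced_on_classes n A (f x) f"
  have class_eq: "spheroid_homotopic n Z z `` {h} = spheroid_homotopic n Z z `` {k}"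
    if "(h, k) \<in> spheroid_homotopic n Z z" for Z :: "'c topology" and z h k
    using that by (auto simp: spheroid_homotopic_def intro: homotopic_with_trans homotopic_with_symD)
  have refl_A: "(k, k) \<in> ?RA" if "k \<in> spheroids n A (f x)" for k
    using that by (simp add: spheroid_homotopic_def spheroids_def)
  have refl_S: "(k, k) \<in> ?RS" if "k \<in> spheroids n S x" for k
    using that by (simp add: spheroid_homotopic_def spheroids_def)
  have classes: "?RA `` {h} = ?RA `` {k} \<longleftrightarrow> (h, k) \<in> ?RA" if "k \<in> spheroids n A (f x)" for h k
  proof
    assume "?RA `` {h} = ?RA `` {k}"
    then show "(h, k) \<in> ?RA"
      using refl_A[OF that] by blast
  qed (rule class_eq)
  have push: "(f \<circ> h, f \<circ> k) \<in> ?RA" if "(h, k) \<in> ?RS" for h k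
    using that cont_f unfolding spheroid_homotopic_def mem_Collect_eq case_prod_conv
    by (elim homotopic_with_compose_continuous_map_left) auto
  have f_sph: "f \<circ> k \<in> spheroids n A (f x)" if "k \<in> spheroids n S x" for k
    using that continuous_map_compose[OF _ cont_f] by (force simp: spheroids_def)
  have F: "?F (?RS `` {k}) = ?RA `` {f \<circ> k}" if k: "k \<in> spheroids n S x" for k
  proof -
    have "?RA `` {f \<circ> h} = ?RA `` {f \<circ> k}" if "(k, h) \<in> ?RS" for h
      using class_eq[OF push[OF that]] by simp
    then have "?F (?RS `` {k}) = (\<Union>h\<in>?RS `` {k}. ?RA `` {f \<circ> k})"
      unfolding induced_on_classes_def by auto
    then show ?thesis
      using refl_S[OF k] by auto
  qed
  have reflect: "(h, k) \<in> ?RS"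
    if h: "h \<in> spheroids n S x" and k: "k \<in> spheroids n S x" and hk: "(f \<circ> h, f \<circ> k) \<in> ?RA" for h k
  proof -
    have cong: "(p ` cube_boundary n \<subseteq> {x}) = (q ` cube_boundary n \<subseteq> {x})"
      if "\<And>z. z \<in> topspace (cube n) \<Longrightarrow> p z = q z" for p q
      using that by (auto simp: cube_boundary_def)
    obtain J where J: "continuous_map (cylinder n) A J" "\<forall>z. J (0, z) = f (h z)"
      "\<forall>z. J (1, z) = f (k z)" "\<forall>t\<in>{0..1}. (\<lambda>z. J (t, z)) ` cube_boundary n \<subseteq> {f x}"
      using hk by (auto simp: spheroid_homotopic_def homotopic_with_def)
    have hx: "h z = x" "k z = x" if "z \<in> cube_boundary n" for z
      using h k that by (auto simp: spheroids_def)
    obtain N where N: "continuous_map (cylinder n) S N"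
      "\<And>z. z \<in> topspace (cube n) \<Longrightarrow> N (0, z) = h z"
      "\<And>z. z \<in> topspace (cube n) \<Longrightarrow> N (1, z) = k z"
      "\<And>t z. 0 \<le> t \<Longrightarrow> t \<le> 1 \<Longrightarrow> z \<in> cube_boundary n \<Longrightarrow> N (t, z) = h z"
    proof (rule lift_homotopy[of n h k J])
      show "J (t, z) = f (h z)" if "0 \<le> t" "t \<le> 1" "z \<in> cube_boundary n" for t z
        using J(4) that hx by fastforce
    qed (use h k J hx in \<open>auto simp: spheroids_def\<close>)
    have "homotopic_with (\<lambda>k. k ` cube_boundary n \<subseteq> {x}) (cube n) S h k"
      using N hx by (subst homotopic_with[OF cong]) (auto intro!: exI[of _ N])
    then show ?thesis
      by (simp add: spheroid_homotopic_def)
  qed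
  have quot: "homotopy_classes n Z z = (\<lambda>k. spheroid_homotopic n Z z `` {k}) ` spheroids n Z z"
    for Z :: "'c topology" and z
    by (auto simp: homotopy_classes_def quotient_def)
  show ?thesis
    unfolding bij_betw_def quot
  proof
    show "inj_on ?F ((\<lambda>k. ?RS `` {k}) ` spheroids n S x)"
      by (rule inj_onI) (auto simp: F classes f_sph intro!: class_eq reflect)
    show "?F ` (\<lambda>k. ?RS `` {k}) ` spheroids n S x = (\<lambda>k. ?RA `` {k}) ` spheroids n A (f x)"
    proof (intro equalityI subsetI)
      fix c assume "c \<in> ?F ` (\<lambda>k. ?RS `` {k}) ` spheroids n S x"
      then show "c \<in> (\<lambda>k. ?RA `` {k}) ` spheroids n A (f x)"
        using F f_sph by auto
    next
      fix c assume "c \<in> (\<lambda>k. ?RA `` {k}) ` spheroids n A (f x)"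
      then obtain h where h: "h \<in> spheroids n A (f x)" "c = ?RA `` {h}"
        by blast
      obtain k where k: "k \<in> spheroids n S x" "(f \<circ> k, h) \<in> ?RA"
        using lift_spheroid[OF x h(1)] by (auto simp: spheroid_homotopic_def)
      then have "c = ?F (?RS `` {k})"
        using F[OF k(1)] class_eq[OF k(2)] h(2) by simp
      then show "c \<in> ?F ` (\<lambda>k. ?RS `` {k}) ` spheroids n S x"
        using k(1) by blast
    qed
  qed
qed

lemma weak_homotopy_equivalence_f: "weak_homotopy_equivalence S A f"
  by (simp add: weak_homotopy_equivalence_def cont_f bij_path_components bij_homotopy_classes)

end

section \<open>Embeddings of function spaces\<close>

text \<open>Reals correspond to sets of naturals. A sequence of such sets is a subset of
  \<open>nat \<times> nat\<close>, which is coded as a set of naturals again.\<close>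

lemma ex_inj_sequences_real: "\<exists>b :: (nat \<Rightarrow> real) \<Rightarrow> real. inj b"
proof -
  obtain a :: "nat set \<Rightarrow> real" where a: "bij a"
    using nat_sets_eqpoll_reals by (auto simp: eqpoll_def)
  define b where "b F = a (prod_encode ` (SIGMA n:UNIV. inv a (F n)))" for F
  have "inj b"
  proof (rule injI)
    fix F G assume "b F = b G"
    then have "(SIGMA n:UNIV. inv a (F n)) = (SIGMA n:UNIV. inv a (G n))"
      unfolding b_def using a inj_prod_encode
      by (metis bij_is_inj inj_image_eq_iff inj_eq)
    then have "inv a (F n) = inv a (G n)" for n
      by (auto simp: set_eq_iff)
    then show "F = G"
      using a by (metis bij_inv_eq_iff ext)
  qed
  then show ?thesis by blast
qed

text \<open>Constant functions place a copy of the reals in \<open>'u\<close>, and a height together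
  with a sequence is coded by one real. This supplies the embedding of cylinder points into the type
  of the test spaces.\<close>

lemma ex_inj_real_power:
  fixes e :: "('v \<Rightarrow> real) \<Rightarrow> 'u"
  assumes "inj e"
  shows "\<exists>j :: real \<times> (nat \<Rightarrow> real) \<Rightarrow> 'u set set. inj j"
proof -
  obtain b :: "(nat \<Rightarrow> real) \<Rightarrow> real" where b: "inj b"
    using ex_inj_sequences_real by blast
  define j where "j = (\<lambda>(s, f). {{e (\<lambda>_. b (case_nat s f))}})"
  have "inj j"
  proof (rule injI)
    fix x y assume eq: "j x = j y"
    obtain s f t g where xy: "x = (s, f)" "y = (t, g)" by (cases x, cases y)
    have "(\<lambda>_::'v. b (case_nat s f)) = (\<lambda>_. b (case_nat t g))"
      using eq assms by (simp add: j_def xy inj_eq)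
    then have "b (case_nat s f) = b (case_nat t g)"
      by (rule fun_cong)
    then have "case_nat s f = case_nat t g"
      using b by (simp add: inj_eq)
    then have "case_nat s f n = case_nat t g n" for n
      by simp
    from this[of 0] this[of "Suc _"] show "x = y"
      by (auto simp: xy)
  qed
  then show ?thesis by blast
qed

text \<open>The factor \<open>nat\<close> makes the target infinite even for finite
  \<open>'q\<close>, so it is equipotent with its square. The summand \<open>bool\<close> reserves
  two indices for the two real parameters of the interpolating space.\<close>

lemma ex_inj_into_prod_nat:
  fixes j :: "'p \<Rightarrow> 'q"
  assumes "inj j"
  shows "\<exists>k :: ('p \<times> 'q) + bool \<Rightarrow> 'q \<times> nat. inj k"
proof -
  have "infinite (UNIV :: ('q \<times> nat) set)"
    by (simp add: finite_prod)
  then have "(card_of ((UNIV :: ('q \<times> nat) set) \<times> (UNIV :: ('q \<times> nat) set)), card_of (UNIV :: ('q \<times> nat) set)) \<in> ordIso"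
    by (rule card_of_Times_same_infinite)
  then obtain p :: "('q \<times> nat) \<times> ('q \<times> nat) \<Rightarrow> 'q \<times> nat" where p: "inj p"
    by (auto simp flip: card_of_ordIso simp: bij_betw_def)
  \<comment> \<open>The tags 0 and 1 in the first component keep pairs and booleans apart.\<close>
  define k where "k = case_sum (\<lambda>(a, c). p ((j a, 0), (c, 0)))
      (\<lambda>b. p ((undefined, 1), (undefined, if b then 0 else 1)))"
  have "inj k"
    by (rule injI) (auto simp: k_def inj_eq[OF p] inj_eq[OF assms] split: sum.splits if_splits)
  then show ?thesis by blast
qed

text \<open>A point with its two parameters is a real function on \<open>'v + bool\<close>. Along
  \<open>k\<close> it becomes a function on \<open>'q \<times> nat\<close>, hence a family of real
  sequences indexed by \<open>'q\<close>, and each sequence is coded by one real.\<close>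

lemma ex_inj_functions:
  fixes k :: "'v + bool \<Rightarrow> 'q \<times> nat"
  assumes "inj k"
  shows "\<exists>i :: ('v \<Rightarrow> real) \<times> real \<times> real \<Rightarrow> 'q \<Rightarrow> real. inj i"
proof -
  obtain b :: "(nat \<Rightarrow> real) \<Rightarrow> real" where b: "inj b"
    using ex_inj_sequences_real by blast
  define F where "F = (\<lambda>(x, s, t). case_sum x (\<lambda>c. if c then s else t :: real) :: 'v + bool \<Rightarrow> real)"
  define i where "i z q = b (\<lambda>n. F z (inv k (q, n)))" for z q
  have "inj i"
  proof (rule injI)
    fix y z assume eq: "i y = i z"
    have "(\<lambda>n. F y (inv k (q, n))) = (\<lambda>n. F z (inv k (q, n)))" for q
      using fun_cong[OF eq, of q] b by (simp add: i_def inj_eq)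
    then have "F y (inv k (q, n)) = F z (inv k (q, n))" for q n
      by (rule fun_cong)
    then have F: "F y a = F z a" for a
      using inv_f_f[OF assms, of a] by (metis surj_pair)
    obtain x s t x' s' t' where yz: "y = (x, s, t)" "z = (x', s', t')"
      by (cases y, cases z)
    show "y = z"
      using F[of "Inl _"] F[of "Inr True"] F[of "Inr False"] by (auto simp: F_def yz)
  qed
  then show ?thesis by blast
qed

text \<open>Cardinals are comparable, so one vertex type embeds in the other. The product is then
  absorbed by the larger type, whose realization coordinates embed in \<open>'u\<close>.\<close>

lemma ex_inj_product_functions:
  fixes e :: "('p \<Rightarrow> real) \<Rightarrow> 'u" and e' :: "('q \<Rightarrow> real) \<Rightarrow> 'u"
  assumes "inj e" "inj e'"
  shows "\<exists>i :: ('p \<times> 'q \<Rightarrow> real) \<times> real \<times> real \<Rightarrow> 'u. inj i"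
proof -
  have "(\<exists>j :: 'p \<Rightarrow> 'q. inj j) \<or> (\<exists>j :: 'q \<Rightarrow> 'p. inj j)"
    using ordLeq_total[OF card_of_Well_order card_of_Well_order, of "UNIV :: 'p set" "UNIV :: 'q set"]
    by (simp flip: card_of_ordLeq)
  then show ?thesis
  proof (elim disjE exE)
    fix j :: "'p \<Rightarrow> 'q" assume "inj j"
    then obtain i :: "('p \<times> 'q \<Rightarrow> real) \<times> real \<times> real \<Rightarrow> 'q \<Rightarrow> real" where "inj i"
      using ex_inj_into_prod_nat ex_inj_functions by metis
    then have "inj (e' \<circ> i)"
      using assms(2) by (simp add: inj_compose)
    then show ?thesis by blast
  next
    fix j :: "'q \<Rightarrow> 'p" assume "inj j"
    then obtain k :: "('q \<times> 'p) + bool \<Rightarrow> 'p \<times> nat" where k: "inj k"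
      using ex_inj_into_prod_nat by blast
    have "inj (map_sum prod.swap id :: ('p \<times> 'q) + bool \<Rightarrow> _)"
      by (auto simp: inj_def map_sum_def split: sum.splits)
    then have "inj (k \<circ> map_sum prod.swap id :: ('p \<times> 'q) + bool \<Rightarrow> _)"
      using k by (simp add: inj_compose)
    then obtain i :: "('p \<times> 'q \<Rightarrow> real) \<times> real \<times> real \<Rightarrow> 'p \<Rightarrow> real" where "inj i"
      using ex_inj_functions by blast
    then have "inj (e \<circ> i)"
      using assms(1) by (simp add: inj_compose)
    then show ?thesis by blast
  qed
qed

section \<open>Subcomplexes and filtrations\<close>

text \<open>A simplex of \<open>L\<close> meets the realization of \<open>K\<close> in those of its
  faces that belong to \<open>K\<close>, and there are finitely many. Hence a map into the larger
  realization with values in the smaller one is continuous into the smaller one.\<close>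

lemma closedin_realization_subcomplex:
  assumes K: "simplicial_complex K" "K \<subseteq> L" and L: "simplicial_complex L"
    and V: "closedin (geometric_realization K) V"
  shows "closedin (geometric_realization L) V"
  unfolding closedin_geometric_realization
proof (intro conjI ballI)
  have VK: "V \<subseteq> carrier K"
    using closedin_subset[OF V] by simp
  then show "V \<subseteq> carrier L"
    using carrier_mono[OF K(2)] by blast
  fix \<sigma> assume "\<sigma> \<in> L"
  then have fin: "finite \<sigma>"
    using L by (simp add: simplicial_complex_def)
  let ?F = "{\<tau> \<in> K. \<tau> \<subseteq> \<sigma>}"
  have eq: "V \<inter> closed_simplex \<sigma> = (\<Union>\<tau>\<in>?F. V \<inter> closed_simplex \<tau>)"
  proof (intro equalityI subsetI)
    fix x assume x: "x \<in> V \<inter> closed_simplex \<sigma>"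
    then have "support x \<in> K" "x \<in> closed_simplex (support x)"
      using carrier_support[OF K(1), of x] VK by auto
    moreover have "support x \<subseteq> \<sigma>"
      using support_closed_simplex(1)[of x \<sigma>] x fin by simp
    ultimately show "x \<in> (\<Union>\<tau>\<in>?F. V \<inter> closed_simplex \<tau>)"
      using x by blast
  qed (use closed_simplex_mono fin in fastforce)
  have "closedin (simplex_topology \<sigma>) (V \<inter> closed_simplex \<tau>)" if \<tau>: "\<tau> \<in> ?F" for \<tau>
  proof -
    have "closedin (powertop_real UNIV) (V \<inter> closed_simplex \<tau>)"
    proof (rule closedin_trans_full)
      show "closedin (simplex_topology \<tau>) (V \<inter> closed_simplex \<tau>)"
        using V \<tau> by (simp add: closedin_geometric_realization)
      show "closedin (powertop_real UNIV) (closed_simplex \<tau>)"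
        using \<tau> fin by (auto intro: closedin_closed_simplex finite_subset)
    qed
    moreover have "V \<inter> closed_simplex \<tau> \<subseteq> closed_simplex \<sigma>"
      using \<tau> fin closed_simplex_mono[of \<tau> \<sigma>] by auto
    ultimately show ?thesis
      by (rule closedin_subset_topspace)
  qed
  moreover have "finite ?F"
    by (rule finite_subset[of _ "Pow \<sigma>"]) (use fin in auto)
  ultimately show "closedin (simplex_topology \<sigma>) (V \<inter> closed_simplex \<sigma>)"
    by (subst eq, intro closedin_Union) auto
qed

lemma continuous_map_into_subcomplex:
  assumes K: "simplicial_complex K" "K \<subseteq> L" and L: "simplicial_complex L"
    and f: "continuous_map W (geometric_realization L) f" "f ` topspace W \<subseteq> carrier K"
  shows "continuous_map W (geometric_realization K) f"
  unfolding continuous_map_closedin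
proof (intro conjI allI impI)
  show "f \<in> topspace W \<rightarrow> topspace (geometric_realization K)"
    using f(2) by auto
  fix V assume "closedin (geometric_realization K) V"
  then have "closedin (geometric_realization L) V"
    by (rule closedin_realization_subcomplex[OF K L])
  then show "closedin W {z \<in> topspace W. f z \<in> V}"
    by (rule closedin_continuous_map_preimage[OF f(1)])
qed

text \<open>One ambient complex for all stages. It is closed under unions, so straight-line
  homotopies can be formed in it before their admissibility is checked.\<close>

definition full_complex :: "'v set set" where
  "full_complex = {\<sigma>. finite \<sigma> \<and> \<sigma> \<noteq> {}}"

lemma simplicial_full_complex: "simplicial_complex full_complex"
  by (auto simp: simplicial_complex_def full_complex_def intro: finite_subset)

definition pullback_filtration :: "'v set \<Rightarrow> ('v \<Rightarrow> 'p) \<Rightarrow> (real \<Rightarrow> 'p set set) \<Rightarrow> real \<Rightarrow> 'v set set" where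
  "pullback_filtration C \<pi> X r = {\<sigma>. finite \<sigma> \<and> \<sigma> \<noteq> {} \<and> \<sigma> \<subseteq> C \<and> \<pi> ` \<sigma> \<in> X r}"

lemma simplicial_pullback_filtration:
  assumes "simplicial_filtration X"
  shows "simplicial_filtration (pullback_filtration C \<pi> X)"
  unfolding simplicial_filtration_def
proof (intro conjI allI impI)
  show "pullback_filtration C \<pi> X r \<subseteq> pullback_filtration C \<pi> X s" if "r \<le> s" for r s
    using assms that by (auto simp: simplicial_filtration_def pullback_filtration_def)
  show "simplicial_complex (pullback_filtration C \<pi> X r)" for r
    unfolding simplicial_complex_def
  proof (intro conjI ballI allI impI)
    fix \<sigma> \<tau> assume st: "\<sigma> \<in> pullback_filtration C \<pi> X r" "\<tau> \<subseteq> \<sigma>" "\<tau> \<noteq> {}"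
    have "simplicial_complex (X r)" "\<pi> ` \<sigma> \<in> X r" "\<pi> ` \<tau> \<subseteq> \<pi> ` \<sigma>" "\<pi> ` \<tau> \<noteq> {}"
      using assms st by (auto simp: simplicial_filtration_def pullback_filtration_def)
    then have "\<pi> ` \<tau> \<in> X r"
      unfolding simplicial_complex_def by blast
    then show "\<tau> \<in> pullback_filtration C \<pi> X r"
      using st by (auto simp: pullback_filtration_def intro: finite_subset)
  qed (auto simp: pullback_filtration_def)
qed

lemma simplex_subset_vertex_set:
  assumes "simplicial_filtration X" "\<sigma> \<in> X r"
  shows "\<sigma> \<subseteq> vertex_set (colim_complex X)"
proof
  fix v assume "v \<in> \<sigma>"
  then have "{v} \<in> X r"
    using assms unfolding simplicial_filtration_def simplicial_complex_def
    by (metis empty_subsetI insert_not_empty insert_subset)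
  then show "v \<in> vertex_set (colim_complex X)"
    by (auto simp: vertex_set_def colim_complex_def)
qed

section \<open>The two kinds of \<real>-spaces\<close>

lemma simplicial_filtration_complex: "simplicial_filtration X \<Longrightarrow> simplicial_complex (X r)"
  and simplicial_filtration_mono: "simplicial_filtration X \<Longrightarrow> r \<le> s \<Longrightarrow> X r \<subseteq> X s"
  by (auto simp: simplicial_filtration_def)

lemma is_rspace_realization_rspace:
  assumes X: "simplicial_filtration X" and e: "inj e"
  shows "is_rspace (realization_rspace e X)"
  unfolding is_rspace_def
proof (intro conjI allI impI ballI)
  show "CGWH_space (space_at (realization_rspace e X) r)" for r
    using CGWH_space_transport_realization[OF simplicial_filtration_complex[OF X] e]
    by (simp add: realization_rspace_def)
  fix r s :: real assume "r \<le> s"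
  then have "continuous_map (transport_topology e (geometric_realization (X r)))
      (transport_topology e (geometric_realization (X s))) (e \<circ> ((\<lambda>x. x) \<circ> inv e))"
    using simplicial_filtration_mono[OF X]
    by (intro continuous_map_compose[OF _ continuous_map_transport_topology(1)[OF e]]
        continuous_map_compose[OF continuous_map_transport_topology(2)[OF e]]
        continuous_map_realization_inclusion)
  then have "continuous_map (transport_topology e (geometric_realization (X r)))
      (transport_topology e (geometric_realization (X s))) (\<lambda>x. x)"
    by (rule continuous_map_eq) (use e in auto)
  then show "continuous_map (space_at (realization_rspace e X) r) (space_at (realization_rspace e X) s)
      (internal_map (realization_rspace e X) r s)"
    by (simp add: realization_rspace_def)
qed (auto simp: realization_rspace_def)

lemma is_rspace_sublevel_filtration:
  assumes "Hausdorff_space T"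
  shows "is_rspace (sublevel_filtration T \<gamma>)"
  unfolding is_rspace_def
proof (intro conjI allI impI ballI)
  show "CGWH_space (space_at (sublevel_filtration T \<gamma>) r)" for r
    by (simp add: sublevel_filtration_def CGWH_space_k_ification Hausdorff_space_subtopology assms)
  fix r s :: real assume "r \<le> s"
  then have "continuous_map (subtopology T {x \<in> topspace T. \<gamma> x \<le> r})
      (subtopology T {x \<in> topspace T. \<gamma> x \<le> s}) (\<lambda>x. x)"
    by (intro continuous_map_into_subtopology continuous_map_from_subtopology)
      (auto simp flip: id_def)
  then show "continuous_map (space_at (sublevel_filtration T \<gamma>) r) (space_at (sublevel_filtration T \<gamma>) s)
      (internal_map (sublevel_filtration T \<gamma>) r s)"
    by (simp add: sublevel_filtration_def continuous_map_k_ification)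
qed (auto simp: sublevel_filtration_def)

section \<open>The interpolating space\<close>

text \<open>A copy \<open>Z\<close> of \<open>|full_complex| \<times> \<real> \<times> \<real>\<close> in which the points \<open>(x, s, t)\<close> with \<open>x \<in> |A\<^sub>s|\<close>,
  \<open>x \<in> |B\<^sub>t|\<close> and \<open>\<bar>s - t\<bar> \<le> \<delta>\<close> are considered.  The sublevel set \<open>s \<le> r\<close> retracts to a copy
  of \<open>|A\<^sub>r|\<close> at \<open>(r, r + \<delta>)\<close>: along the segment from \<open>(s, t)\<close> to \<open>(r, r + \<delta>)\<close> both parameters
  increase, so the point \<open>x\<close> remains admissible.\<close>

locale interpolation =
  fixes Z :: "'u topology" and \<xi> :: "'u \<Rightarrow> 'v \<Rightarrow> real" and a b :: "'u \<Rightarrow> real"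
    and mk :: "('v \<Rightarrow> real) \<Rightarrow> real \<Rightarrow> real \<Rightarrow> 'u"
    and C :: "'v set" and \<pi> :: "'v \<Rightarrow> 'p" and X :: "real \<Rightarrow> 'p set set"
    and B :: "real \<Rightarrow> 'v set set" and \<delta> :: real and e :: "('p \<Rightarrow> real) \<Rightarrow> 'u"
  assumes Hausdorff_Z: "Hausdorff_space Z"
    and cont_\<xi>: "continuous_map Z (geometric_realization full_complex) \<xi>"
    and cont_a: "continuous_map Z euclideanreal a"
    and cont_b: "continuous_map Z euclideanreal b"
    and cont_mk: "continuous_map
      (prod_topology (geometric_realization full_complex) (prod_topology euclideanreal euclideanreal)) Z
      (\<lambda>(x, s, t). mk x s t)"
    and coords_mk: "\<xi> (mk x s t) = x" "a (mk x s t) = s" "b (mk x s t) = t"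
    and mk_coords: "z \<in> topspace Z \<Longrightarrow> mk (\<xi> z) (a z) (b z) = z"
    and X: "simplicial_filtration X" and B: "simplicial_filtration B"
    and \<pi>: "\<And>r \<sigma>. \<sigma> \<in> X r \<Longrightarrow> \<sigma> \<subseteq> \<pi> ` C"
    and \<delta>: "0 \<le> \<delta>" and AB: "pullback_filtration C \<pi> X r \<subseteq> B (r + \<delta>)"
    and e: "inj e"
begin

abbreviation A :: "real \<Rightarrow> 'v set set" where
  "A \<equiv> pullback_filtration C \<pi> X"

abbreviation sec :: "'p \<Rightarrow> 'v" where
  "sec \<equiv> inv_into C \<pi>"

definition admissible :: "'u set" where
  "admissible = {z \<in> topspace Z. \<xi> z \<in> carrier (A (a z)) \<and> \<xi> z \<in> carrier (B (b z)) \<and> \<bar>a z - b z\<bar> \<le> \<delta>}"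

definition sublevel :: "real \<Rightarrow> 'u set" where
  "sublevel r = {z \<in> admissible. a z \<le> r}"

definition proj :: "'u \<Rightarrow> 'u" where
  "proj z = e (push \<pi> (\<xi> z))"

text \<open>The inclusion of \<open>A r\<close> in \<open>B (r + \<delta>)\<close> makes the second
  parameter \<open>r + \<delta>\<close> valid for every point of the stage, and it is the largest
  one compatible with \<open>\<bar>s - t\<bar> \<le> \<delta>\<close>. It therefore bounds all
  second parameters that occur in \<open>sublevel r\<close>.\<close>

definition base :: "real \<Rightarrow> 'u \<Rightarrow> 'u" where
  "base r y = mk (push sec (inv e y)) r (r + \<delta>)"

text \<open>In the first half of the time \<open>l\<close> raises the parameters, in the second half
  \<open>m\<close> moves the point. The order matters: the moving point stays in \<open>A r\<close>,
  hence in \<open>B (r + \<delta>)\<close>, but it could leave the earlier stage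
  \<open>B (b z)\<close>.\<close>

definition retract :: "real \<Rightarrow> real \<Rightarrow> 'u \<Rightarrow> 'u" where
  "retract r t z =
     (let l = min 1 (2 * t); m = max 0 (2 * t - 1) in
      mk (\<lambda>v. (1 - m) * \<xi> z v + m * push (sec \<circ> \<pi>) (\<xi> z) v)
        ((1 - l) * a z + l * r) ((1 - l) * b z + l * (r + \<delta>)))"

lemma continuous_map_mk:
  assumes "continuous_map W (geometric_realization full_complex) x"
    "continuous_map W euclideanreal s" "continuous_map W euclideanreal t"
  shows "continuous_map W Z (\<lambda>z. mk (x z) (s z) (t z))"
  using continuous_map_compose[OF continuous_map_pairedI[OF assms(1)
        continuous_map_pairedI[OF assms(2,3)]] cont_mk]
  by (simp add: o_def)

lemma A_mono: "r \<le> s \<Longrightarrow> A r \<subseteq> A s"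
  and A_complex: "simplicial_complex (A r)"
  by (rule simplicial_filtration_mono[OF simplicial_pullback_filtration[OF X]], assumption)
    (rule simplicial_filtration_complex[OF simplicial_pullback_filtration[OF X]])

lemma A_full: "A r \<subseteq> full_complex"
  by (auto simp: pullback_filtration_def full_complex_def)

lemma proj_sec: "\<sigma> \<in> X r \<Longrightarrow> p \<in> \<sigma> \<Longrightarrow> \<pi> (sec p) = p \<and> sec p \<in> C"
  using \<pi> by (meson f_inv_into_f inv_into_into subsetD)

lemma sec_image:
  assumes "\<sigma> \<in> X r"
  shows "sec ` \<sigma> \<in> A r"
proof -
  have "finite \<sigma>" "\<sigma> \<noteq> {}"
    using simplicial_filtration_complex[OF X, of r] assms by (auto simp: simplicial_complex_def)
  moreover have "\<pi> ` sec ` \<sigma> = \<sigma>"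
    using proj_sec[OF assms] by (force simp: image_image)
  ultimately show ?thesis
    using assms proj_sec[OF assms] by (auto simp: pullback_filtration_def)
qed

text \<open>Adding \<open>(sec \<circ> \<pi>)\<close> to the vertices does not change the projection
  to \<open>X\<close>, and membership in \<open>A r\<close> depends on that projection. So the
  identity and \<open>sec \<circ> \<pi>\<close> are contiguous on \<open>A r\<close>.\<close>

lemma sec_closure:
  assumes "\<sigma> \<in> A r"
  shows "\<sigma> \<union> (sec \<circ> \<pi>) ` \<sigma> \<in> A r"
proof -
  have s: "finite \<sigma>" "\<sigma> \<subseteq> C" "\<pi> ` \<sigma> \<in> X r" "\<sigma> \<noteq> {}"
    using assms by (auto simp: pullback_filtration_def)
  have "\<pi> ` (\<sigma> \<union> (sec \<circ> \<pi>) ` \<sigma>) = \<pi> ` \<sigma>"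
    using proj_sec[OF s(3)] by (force simp: image_Un image_image)
  moreover have "(sec \<circ> \<pi>) ` \<sigma> \<subseteq> C"
    using proj_sec[OF s(3)] by auto
  ultimately show ?thesis
    using s by (simp add: pullback_filtration_def)
qed

lemma sublevel_simplex:
  assumes "z \<in> sublevel r"
  obtains \<sigma> where "\<sigma> \<in> A (a z)" "\<xi> z \<in> closed_simplex \<sigma>" "finite \<sigma>" "\<pi> ` \<sigma> \<in> X (a z)" "a z \<le> r"
  using assms by (auto simp: sublevel_def admissible_def carrier_def pullback_filtration_def)

text \<open>Contiguity keeps the segment in the realization of \<open>A r\<close>. It stays in one
  fibre because \<open>push \<pi>\<close> is affine and
  \<open>\<pi> \<circ> sec \<circ> \<pi>\<close> equals \<open>\<pi>\<close> on the simplex.\<close>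

lemma retract_point:
  assumes "\<sigma> \<in> A r" "x \<in> closed_simplex \<sigma>" "0 \<le> m" "m \<le> 1"
  shows "(\<lambda>v. (1 - m) * x v + m * push (sec \<circ> \<pi>) x v) \<in> carrier (A r)"
    and "push \<pi> (\<lambda>v. (1 - m) * x v + m * push (sec \<circ> \<pi>) x v) = push \<pi> x"
proof -
  let ?\<sigma> = "\<sigma> \<union> (sec \<circ> \<pi>) ` \<sigma>"
  have s: "finite \<sigma>" "finite ?\<sigma>" "\<pi> ` \<sigma> \<in> X r"
    using assms(1) by (auto simp: pullback_filtration_def)
  have x: "x \<in> closed_simplex ?\<sigma>"
    using assms(2) closed_simplex_mono[of \<sigma> ?\<sigma>] s by blast
  have y: "push (sec \<circ> \<pi>) x \<in> closed_simplex ?\<sigma>"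
    using push_closed_simplex[OF s(1) assms(2), of "sec \<circ> \<pi>"]
      closed_simplex_mono[of "(sec \<circ> \<pi>) ` \<sigma>" ?\<sigma>] s(2) by blast
  show "(\<lambda>v. (1 - m) * x v + m * push (sec \<circ> \<pi>) x v) \<in> carrier (A r)"
    using closed_simplex_convex[OF x y assms(3,4)] sec_closure[OF assms(1)]
    unfolding carrier_def by blast
  have push: "push \<pi> (\<lambda>v. (1 - m) * x v + m * push (sec \<circ> \<pi>) x v)
      = (\<lambda>w. (1 - m) * push \<pi> x w + m * push \<pi> (push (sec \<circ> \<pi>) x) w)"
    by (rule push_linear[OF s(2) x y])
  have "push \<pi> (push (sec \<circ> \<pi>) x) = push (\<pi> \<circ> sec) (push \<pi> x)"
    by (simp add: push_push[OF s(1) assms(2)] o_assoc)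
  also have "\<dots> = push \<pi> x"
    using s(1) proj_sec[OF s(3)] push_closed_simplex[OF s(1) assms(2), of \<pi>]
    by (intro push_ident[of "\<pi> ` \<sigma>"]) auto
  finally show "push \<pi> (\<lambda>v. (1 - m) * x v + m * push (sec \<circ> \<pi>) x v) = push \<pi> x"
    unfolding push by (simp add: fun_eq_iff algebra_simps)
qed

lemma base_in:
  assumes "y \<in> carrier (X r)"
  shows "push sec y \<in> carrier (A r)" "push sec y \<in> carrier (B (r + \<delta>))" "push \<pi> (push sec y) = y"
proof -
  obtain \<sigma> where s: "\<sigma> \<in> X r" "y \<in> closed_simplex \<sigma>"
    using assms by (auto simp: carrier_def)
  have fin: "finite \<sigma>"
    using simplicial_filtration_complex[OF X, of r] s by (auto simp: simplicial_complex_def)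
  show "push sec y \<in> carrier (A r)"
    using push_closed_simplex[OF fin s(2)] sec_image[OF s(1)] by (auto simp: carrier_def)
  then show "push sec y \<in> carrier (B (r + \<delta>))"
    using carrier_mono[OF AB] by blast
  show "push \<pi> (push sec y) = y"
    using proj_sec[OF s(1)] by (simp add: push_push[OF fin s(2)] push_ident[OF fin s(2)])
qed

lemma retract_in:
  assumes z: "z \<in> sublevel r" and t: "0 \<le> t" "t \<le> 1" and Z: "retract r t z \<in> topspace Z"
  shows "retract r t z \<in> sublevel r"
proof -
  define l where "l = min 1 (2 * t)"
  define m where "m = max 0 (2 * t - 1)"
  define x' where "x' = (\<lambda>v. (1 - m) * \<xi> z v + m * push (sec \<circ> \<pi>) (\<xi> z) v)"
  define a' where "a' = (1 - l) * a z + l * r"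
  define b' where "b' = (1 - l) * b z + l * (r + \<delta>)"
  have ret: "retract r t z = mk x' a' b'"
    by (simp add: retract_def Let_def l_def m_def x'_def a'_def b'_def)
  have l: "0 \<le> l" "l \<le> 1" and m: "0 \<le> m" "m \<le> 1"
    using t by (auto simp: l_def m_def)
  have az: "a z \<le> r" "\<bar>a z - b z\<bar> \<le> \<delta>" "\<xi> z \<in> carrier (B (b z))"
    using z by (auto simp: sublevel_def admissible_def)
  obtain \<sigma> where s: "\<sigma> \<in> A (a z)" "\<xi> z \<in> closed_simplex \<sigma>"
    using sublevel_simplex[OF z] by metis
  \<comment> \<open>The second inequality uses
    \<open>b z \<le> a z + \<delta> \<le> r + \<delta>\<close>; together they say that both
    parameters increase and that the first stays at most \<open>r\<close>.\<close>
  have "l * (r - a z) \<ge> 0" "l * (r + \<delta> - b z) \<ge> 0" "(1 - l) * (r - a z) \<ge> 0"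
    using l az by (auto intro!: mult_nonneg_nonneg)
  then have a': "a z \<le> a'" "a' \<le> r" and b': "b z \<le> b'"
    by (auto simp: a'_def b'_def algebra_simps)
  have "\<bar>a' - b'\<bar> \<le> \<bar>(1 - l) * (a z - b z)\<bar> + \<bar>l * \<delta>\<bar>"
    by (simp add: a'_def b'_def algebra_simps)
  also have "\<dots> \<le> (1 - l) * \<delta> + l * \<delta>"
    using l \<delta> az by (auto simp: abs_mult intro!: mult_left_mono)
  finally have ab: "\<bar>a' - b'\<bar> \<le> \<delta>"
    by (simp add: algebra_simps)
  have x': "x' \<in> carrier (A a') \<and> x' \<in> carrier (B b')"
  \<comment> \<open>Either the point has not moved and monotonicity of both filtrations applies, or
    the parameters have already reached \<open>(r, r + \<delta>)\<close>.\<close>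
  proof (cases "m = 0")
    case True
    then have "x' = \<xi> z"
      by (simp add: x'_def)
    moreover have "\<xi> z \<in> carrier (A (a z))"
      using s by (auto simp: carrier_def)
    ultimately show ?thesis
      using az(3) carrier_mono[OF A_mono[OF a'(1)]]
        carrier_mono[OF simplicial_filtration_mono[OF B b']] by auto
  next
    case False
    then have "l = 1"
      by (auto simp: l_def m_def max_def split: if_splits)
    then have "a' = r" "b' = r + \<delta>"
      by (auto simp: a'_def b'_def)
    moreover have "\<sigma> \<in> A r"
      using s(1) A_mono[OF az(1)] by blast
    ultimately show ?thesis
      using retract_point(1)[of \<sigma> r "\<xi> z" m] s(2) m carrier_mono[OF AB] by (auto simp: x'_def)
  qed
  show ?thesis
    using x' ab a' Z by (simp add: ret sublevel_def admissible_def coords_mk)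
qed

lemma shrinkable_proj:
  fixes j :: "real \<times> (nat \<Rightarrow> real) \<Rightarrow> 'u set set"
  assumes j: "inj j"
  shows "shrinkable (k_ification (subtopology Z (sublevel r)))
    (transport_topology e (geometric_realization (X r))) proj (base r) (retract r)"
proof
  let ?S = "subtopology Z (sublevel r)" and ?R = "geometric_realization (X r)"
  let ?A = "transport_topology e ?R"
  have sub: "sublevel r \<subseteq> topspace Z"
    by (auto simp: sublevel_def admissible_def)
  then have top: "topspace (k_ification ?S) = sublevel r"
    by auto
  have "continuous_map ?S (geometric_realization (A r)) \<xi>"
  proof (rule continuous_map_into_subcomplex[OF A_complex A_full simplicial_full_complex])
    show "continuous_map ?S (geometric_realization full_complex) \<xi>"
      by (rule continuous_map_from_subtopology[OF cont_\<xi>])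
    show "\<xi> ` topspace ?S \<subseteq> carrier (A r)"
      using carrier_mono[OF A_mono] by (fastforce simp: sublevel_def admissible_def)
  qed
  moreover have "continuous_map (geometric_realization (A r)) ?R (push \<pi>)"
    by (rule continuous_map_push[OF A_complex simplicial_filtration_complex[OF X]])
      (simp add: pullback_filtration_def)
  ultimately have "continuous_map ?S ?A (e \<circ> (push \<pi> \<circ> \<xi>))"
    by (intro continuous_map_compose[OF _ continuous_map_transport_topology(1)[OF e]]
        continuous_map_compose[where g = "push \<pi>"])
  then show "continuous_map (k_ification ?S) ?A proj"
    by (intro continuous_map_from_k_ification) (simp add: proj_def[abs_def] o_def)
  have "continuous_map ?R (geometric_realization full_complex) (push sec)"
  proof (rule continuous_map_push[OF simplicial_filtration_complex[OF X] simplicial_full_complex])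
    show "sec ` \<sigma> \<in> full_complex" if "\<sigma> \<in> X r" for \<sigma>
      using sec_image[OF that] A_full by blast
  qed
  then have "continuous_map ?A (geometric_realization full_complex) (push sec \<circ> inv e)"
    by (rule continuous_map_compose[OF continuous_map_transport_topology(2)[OF e]])
  then have base: "continuous_map ?A Z (base r)"
    unfolding base_def by (intro continuous_map_mk) (auto simp: o_def)
  have "base r y \<in> sublevel r" if y: "y \<in> topspace ?A" for y
  proof -
    obtain y' where "y = e y'" "y' \<in> carrier (X r)"
      using y e by auto
    moreover have "base r y \<in> topspace Z"
      using base y by (auto simp: continuous_map_def)
    ultimately show ?thesis
      using e \<delta> base_in[of y' r] by (simp add: sublevel_def admissible_def base_def coords_mk)
  qed
  then have "continuous_map ?A ?S (base r)"
    using base by (intro continuous_map_into_subtopology) auto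
  \<comment> \<open>Both sides are k-ified; the source does not change, being compactly
    generated.\<close>
  then have "continuous_map (k_ification ?A) (k_ification ?S) (base r)"
    by (rule continuous_map_k_ification)
  then show "continuous_map ?A (k_ification ?S) (base r)"
    using CGWH_space_transport_realization[OF simplicial_filtration_complex[OF X] e]
    by (simp add: CGWH_space_def compactly_generated_space_def)
  show "proj (base r y) = y" if "y \<in> topspace ?A" for y
    using that e base_in(3)[of "inv e y" r] by (auto simp: proj_def base_def coords_mk)
  show "retract r 0 z = z" if "z \<in> topspace (k_ification ?S)" for z
    using that mk_coords[of z] by (simp add: retract_def)
  show "retract r 1 z = base r (proj z)" if "z \<in> topspace (k_ification ?S)" for z
  proof -
    obtain \<sigma> where s: "\<xi> z \<in> closed_simplex \<sigma>" "finite \<sigma>"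
      using sublevel_simplex[of z r] \<open>z \<in> topspace _\<close> unfolding top by metis
    show ?thesis
      using e by (simp add: retract_def base_def proj_def push_push[OF s(2,1)])
  qed
  show "proj (retract r t z) = proj z"
    if "z \<in> topspace (k_ification ?S)" "0 \<le> t" "t \<le> 1" for t z
  proof -
    obtain \<sigma> where s: "\<sigma> \<in> A (a z)" "\<xi> z \<in> closed_simplex \<sigma>"
      using sublevel_simplex[of z r] \<open>z \<in> topspace _\<close> unfolding top by metis
    show ?thesis
      using that retract_point(2)[OF s, of "max 0 (2 * t - 1)"]
      by (simp add: proj_def retract_def Let_def coords_mk)
  qed
  fix W :: "(real \<times> (nat \<Rightarrow> real)) topology" and w t
  assume W: "compact_space W" "Hausdorff_space W" and w: "continuous_map W (k_ification ?S) w"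
    and t: "continuous_map W euclideanreal t" "t ` topspace W \<subseteq> {0..1}"
  have wS: "continuous_map W ?S w"
    by (rule continuous_map_k_ification_full[OF w])
  then have wZ: "continuous_map W Z w" and wi: "\<And>u. u \<in> topspace W \<Longrightarrow> w u \<in> sublevel r"
    by (auto simp: continuous_map_in_subtopology)
  have x: "continuous_map W (geometric_realization full_complex) (\<lambda>u. \<xi> (w u))"
    using continuous_map_compose[OF wZ cont_\<xi>] by (simp add: o_def)
  have "continuous_map (geometric_realization full_complex) (geometric_realization full_complex)
      (push (sec \<circ> \<pi>))"
    by (rule continuous_map_push[OF simplicial_full_complex simplicial_full_complex])
      (auto simp: full_complex_def)
  from continuous_map_compose[OF x this]
  have y: "continuous_map W (geometric_realization full_complex) (\<lambda>u. push (sec \<circ> \<pi>) (\<xi> (w u)))"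
    by (simp add: o_def)
  have "continuous_map W euclideanreal (\<lambda>u. a (w u))" "continuous_map W euclideanreal (\<lambda>u. b (w u))"
    using continuous_map_compose[OF wZ cont_a] continuous_map_compose[OF wZ cont_b]
    by (simp_all add: o_def)
  \<comment> \<open>Compactness of \<open>W\<close> makes the straight-line part continuous here; it
    is also what allows passing to the k-ified target below.\<close>
  then have ret: "continuous_map W Z (\<lambda>u. retract r (t u) (w u))"
    unfolding retract_def Let_def using t(2)
    by (intro continuous_map_mk continuous_map_realization_linear simplicial_full_complex W(1) x y
        continuous_intros t(1)) (auto simp: full_complex_def)
  have "continuous_map W ?S (\<lambda>u. retract r (t u) (w u))"
  proof (rule continuous_map_into_subtopology[OF ret], rule)
    fix u assume u: "u \<in> topspace W"
    then have "retract r (t u) (w u) \<in> topspace Z"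
      using ret unfolding continuous_map_def by blast
    then show "retract r (t u) (w u) \<in> sublevel r"
      using wi[OF u] t(2) u by (intro retract_in) auto
  qed
  then show "continuous_map W (k_ification ?S) (\<lambda>u. retract r (t u) (w u))"
    by (rule continuous_map_into_k_ification[OF j W])
qed

text \<open>The k-ification makes this a CGWH space, so that stability applies to functions on
  it.\<close>

definition model :: "'u topology" where
  "model = k_ification (subtopology Z admissible)"

lemma Hausdorff_space_model: "Hausdorff_space model"
  unfolding model_def
  by (rule Hausdorff_space_injective_preimage[OF _ continuous_map_k_ification_id])
    (simp_all add: Hausdorff_Z Hausdorff_space_subtopology)

lemma CGWH_space_model: "CGWH_space model"
  by (simp add: model_def CGWH_space_k_ification Hausdorff_Z Hausdorff_space_subtopology)

lemma topspace_model: "topspace model = admissible"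
  by (auto simp: model_def admissible_def)

lemma space_at_sublevel_filtration:
  "space_at (sublevel_filtration model a) r = k_ification (subtopology Z (sublevel r))"
proof -
  have "{z \<in> topspace model. a z \<le> r} = sublevel r" "admissible \<inter> sublevel r = sublevel r"
    by (auto simp: topspace_model sublevel_def)
  then show ?thesis
    by (simp add: sublevel_filtration_def)
      (simp add: model_def k_ification_subtopology_k_ification subtopology_subtopology)
qed

text \<open>The map \<open>proj\<close> is the same at every level and all internal maps are
  identities on points, so naturality is immediate and only the levelwise statement has
  content.\<close>

lemma weakly_equivalent_sublevel_filtration:
  "weakly_equivalent (sublevel_filtration model a) (realization_rspace e X)"
proof -
  obtain j :: "real \<times> (nat \<Rightarrow> real) \<Rightarrow> 'u set set" where j: "inj j"
    using ex_inj_real_power[OF e] by blast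
  have "weak_homotopy_equivalence (space_at (sublevel_filtration model a) r)
      (space_at (realization_rspace e X) r) proj" for r
    using shrinkable.weak_homotopy_equivalence_f[OF shrinkable_proj[OF j]]
    by (simp add: space_at_sublevel_filtration) (simp add: realization_rspace_def)
  then have "objectwise_weak_equivalence (sublevel_filtration model a) (realization_rspace e X) (\<lambda>_. proj)"
    by (auto simp: objectwise_weak_equivalence_def natural_transformation_def
        weak_homotopy_equivalence_def) (auto simp: sublevel_filtration_def realization_rspace_def)
  then show ?thesis
    unfolding weakly_equivalent_def
    using is_rspace_sublevel_filtration[OF Hausdorff_space_model] is_rspace_realization_rspace[OF X e]
    by (intro r_into_equivclp) blast
qed

end

theorem proposition6p5:
  fixes X :: "real \<Rightarrow> 'p set set"
    and Y :: "real \<Rightarrow> 'q set set"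
    and P :: "'p set"
    and Q :: "'q set"
    and C :: "('p \<times> 'q) set"
    and \<delta> :: real
    and e\<^sub>X :: "('p \<Rightarrow> real) \<Rightarrow> 'u"
    and e\<^sub>Y :: "('q \<Rightarrow> real) \<Rightarrow> 'u"
    and d :: "'u rspace \<Rightarrow> 'u rspace \<Rightarrow> ennreal"
  assumes "simplicial_filtration X"
    and "simplicial_filtration Y"
    and "P = vertex_set (colim_complex X)"
    and "Q = vertex_set (colim_complex Y)"
    and "0 \<le> \<delta>"
    and "correspondence P Q C"
    and "simplicial_correspondence \<delta> X Y C"
    and "inj e\<^sub>X"
    and "inj e\<^sub>Y"
    and "is_distance d"
    and "stable_distance d"
    and "homotopy_invariant d"
  shows "d (realization_rspace e\<^sub>X X) (realization_rspace e\<^sub>Y Y) \<le> ennreal \<delta>"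
proof -
  obtain \<epsilon> :: "('p \<times> 'q \<Rightarrow> real) \<times> real \<times> real \<Rightarrow> 'u" where \<epsilon>: "inj \<epsilon>"
    using ex_inj_product_functions[OF assms(8,9)] by blast
  let ?R = "geometric_realization full_complex :: ('p \<times> 'q \<Rightarrow> real) topology"
  let ?M = "prod_topology ?R (prod_topology euclideanreal euclideanreal)"
  define Z where "Z = transport_topology \<epsilon> ?M"
  define \<xi> where "\<xi> = fst \<circ> inv \<epsilon>"
  define a where "a = (fst \<circ> snd) \<circ> inv \<epsilon>"
  define b where "b = (snd \<circ> snd) \<circ> inv \<epsilon>"
  define mk where "mk x s t = \<epsilon> (x, s, t)" for x s t
  have cont_inv: "continuous_map Z ?M (inv \<epsilon>)" and cont: "continuous_map ?M Z \<epsilon>"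
    unfolding Z_def by (rule continuous_map_transport_topology[OF \<epsilon>])+
  have "Hausdorff_space ?M"
    by (simp add: Hausdorff_space_prod_topology Hausdorff_space_geometric_realization)
  then have Haus: "Hausdorff_space Z"
    unfolding Z_def using homeomorphic_Hausdorff_space[OF homeomorphic_space_transport_topology[OF \<epsilon>]]
    by blast
  have cont_\<xi>: "continuous_map Z ?R \<xi>"
    unfolding \<xi>_def by (intro continuous_map_compose[OF cont_inv] continuous_map_fst)
  have cont_a: "continuous_map Z euclideanreal a"
    unfolding a_def by (intro continuous_map_compose[OF cont_inv]
        continuous_map_compose[OF continuous_map_snd] continuous_map_fst)
  have cont_b: "continuous_map Z euclideanreal b"
    unfolding b_def by (intro continuous_map_compose[OF cont_inv]
        continuous_map_compose[OF continuous_map_snd] continuous_map_snd)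
  have cont_mk: "continuous_map ?M Z (\<lambda>(x, s, t). mk x s t)"
    using cont by (simp add: mk_def case_prod_beta')
  \<comment> \<open>Exchanging the two parameters lets the same construction treat \<open>Y\<close>
    on the same space.\<close>
  have "continuous_map ?M ?M (\<lambda>z. (fst z, snd (snd z), fst (snd z)))"
    using continuous_map_compose[OF continuous_map_snd continuous_map_fst, of ?R euclideanreal euclideanreal]
      continuous_map_compose[OF continuous_map_snd continuous_map_snd, of ?R euclideanreal euclideanreal]
    by (intro continuous_map_pairedI continuous_map_fst) (simp_all add: o_def)
  from continuous_map_compose[OF this cont_mk]
  have cont_mk': "continuous_map ?M Z (\<lambda>(x, s, t). mk x t s)"
    by (simp add: o_def case_prod_beta')
  have coords: "\<xi> (mk x s t) = x" "a (mk x s t) = s" "b (mk x s t) = t" for x s t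
    using \<epsilon> by (simp_all add: \<xi>_def a_def b_def mk_def)
  have mk_coords: "mk (\<xi> z) (a z) (b z) = z" if "z \<in> topspace Z" for z
    using that \<epsilon> by (auto simp: Z_def \<xi>_def a_def b_def mk_def)
  have fst_C: "fst ` C = P" and snd_C: "snd ` C = Q"
    using assms(6) by (auto simp: correspondence_def)
  let ?A = "pullback_filtration C fst X" and ?B = "pullback_filtration C snd Y"
  have AB: "?A r \<subseteq> ?B (r + \<delta>)" for r
  proof
    fix \<sigma> assume s: "\<sigma> \<in> ?A r"
    then have "fst ` \<sigma> \<in> X r" "finite (snd ` \<sigma>)" "snd ` \<sigma> \<noteq> {}"
      "snd ` \<sigma> \<subseteq> snd ` {c \<in> C. fst c \<in> fst ` \<sigma>}"
      by (auto simp: pullback_filtration_def)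
    moreover have "\<tau> \<in> Y (r + \<delta>)" if "\<rho> \<in> X r" "finite \<tau>" "\<tau> \<noteq> {}"
        "\<tau> \<subseteq> snd ` {c \<in> C. fst c \<in> \<rho>}" for \<rho> \<tau>
      using assms(7) that by (simp add: simplicial_correspondence_def)
    ultimately have "snd ` \<sigma> \<in> Y (r + \<delta>)"
      by blast
    then show "\<sigma> \<in> ?B (r + \<delta>)"
      using s by (simp add: pullback_filtration_def)
  qed
  have BA: "?B r \<subseteq> ?A (r + \<delta>)" for r
  proof
    fix \<sigma> assume s: "\<sigma> \<in> ?B r"
    then have "snd ` \<sigma> \<in> Y r" "finite (fst ` \<sigma>)" "fst ` \<sigma> \<noteq> {}"
      "fst ` \<sigma> \<subseteq> fst ` {c \<in> C. snd c \<in> snd ` \<sigma>}"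
      by (auto simp: pullback_filtration_def)
    moreover have "\<tau> \<in> X (r + \<delta>)" if "\<rho> \<in> Y r" "finite \<tau>" "\<tau> \<noteq> {}"
        "\<tau> \<subseteq> fst ` {c \<in> C. snd c \<in> \<rho>}" for \<rho> \<tau>
      using assms(7) that by (simp add: simplicial_correspondence_def)
    ultimately have "fst ` \<sigma> \<in> X (r + \<delta>)"
      by blast
    then show "\<sigma> \<in> ?A (r + \<delta>)"
      using s by (simp add: pullback_filtration_def)
  qed
  interpret I: interpolation Z \<xi> a b mk C fst X ?B \<delta> e\<^sub>X
    using Haus cont_\<xi> cont_a cont_b cont_mk coords mk_coords assms(1,5,8) AB
      simplicial_pullback_filtration[OF assms(2)] simplex_subset_vertex_set[OF assms(1)] fst_C assms(3)
    by unfold_locales auto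
  interpret J: interpolation Z \<xi> b a "\<lambda>x s t. mk x t s" C snd Y ?A \<delta> e\<^sub>Y
    using Haus cont_\<xi> cont_a cont_b cont_mk' coords mk_coords assms(2,5,9) BA
      simplicial_pullback_filtration[OF assms(1)] simplex_subset_vertex_set[OF assms(2)] snd_C assms(4)
    by unfold_locales auto
  \<comment> \<open>Admissibility is symmetric under exchanging the roles of \<open>X\<close> and
    \<open>Y\<close>, so both sublevel filtrations live on one space and stability can compare
    them.\<close>
  have "J.admissible = I.admissible"
    by (auto simp: I.admissible_def J.admissible_def abs_minus_commute)
  then have model: "J.model = I.model"
    by (simp add: I.model_def J.model_def)
  let ?X = "realization_rspace e\<^sub>X X" and ?Y = "realization_rspace e\<^sub>Y Y"
  let ?SX = "sublevel_filtration I.model a" and ?SY = "sublevel_filtration I.model b"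
  have rspace: "is_rspace ?X" "is_rspace ?Y" "is_rspace ?SX" "is_rspace ?SY"
    using assms(1,2,8,9) is_rspace_realization_rspace
      is_rspace_sublevel_filtration[OF I.Hausdorff_space_model] by blast+
  have zero: "d ?SX ?X = 0" "d ?SY ?Y = 0"
    using assms(12) rspace I.weakly_equivalent_sublevel_filtration
      J.weakly_equivalent_sublevel_filtration unfolding model homotopy_invariant_def by blast+
  have le: "d ?SX ?SY \<le> ennreal \<delta>"
  proof -
    have "d ?SX ?SY \<le> sup_distance I.model a b"
      using assms(11) I.CGWH_space_model by (simp add: stable_distance_def)
    also have "\<dots> \<le> ennreal \<delta>"
      unfolding sup_distance_def I.topspace_model
      by (rule SUP_least) (auto simp: I.admissible_def ennreal_leI)
    finally show ?thesis .
  qed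
  have "d ?X ?Y \<le> d ?X ?SX + d ?SX ?Y" "d ?SX ?Y \<le> d ?SX ?SY + d ?SY ?Y" "d ?X ?SX = d ?SX ?X"
    using assms(10) rspace unfolding is_distance_def by blast+
  then have "d ?X ?Y \<le> d ?SX ?SY"
    by (simp add: zero)
  also note le
  finally show ?thesis .
qed

end
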